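(* For every $r,t\in\mathbb{N}$ with $r\ge 2$, $t\ge 1$ and any $\alpha>0$ there exists $\epsilon>0$ such that the following holds for all sufficiently large $n$. (i) All but at most $f(n,T_3^t)2^{-\epsilon n^2}$ of the labelled $T_3^t$-free oriented graphs on $n$ vertices can be made bipartite by changing at most $\alpha n^2$ edges. (ii) All but at most $f^*(n,T_3^t)2^{-\epsilon n^2}$ of the labelled $T_3^t$-free digraphs on $n$ vertices can be made bipartite by changing at most $\alpha n^2$ edges.
   Context: A digraph is a pair $(V,E)$ with $E$ a set of ordered pairs of distinct vertices; an oriented graph is a digraph with at most one edge between any two vertices. A digraph is bipartite if its underlying undirected graph is bipartite. $T_3$ is the transitive tournament on 3 vertices (edges $xy$, $yz$, $xz$). For a digraph $H$ and positive integer $t$, the blow-up $H^t$ is obtained by replacing each vertex $v$ of $H$ by an independent set $S_v$ of $t$ vertices and, for each edge $uv$ of $H$, adding all edges from $S_u$ to $S_v$. A digraph is $T_3^t$-free if it contains no sub-digraph isomorphic to $T_3^t$. $f(n,T_3^t)$ and $f^*(n,T_3^t)$ denote the number of labelled $T_3^t$-free oriented graphs and labelled $T_3^t$-free digraphs on vertex set $[n]$, respectively. *)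

theory Defs
  imports Complex_Main "Graph_Theory.Pair_Digraph" "Graph_Theory.Digraph_Isomorphism"
begin

definition oriented_graph :: "'a pair_pre_digraph \<Rightarrow> bool" where
  "oriented_graph G \<longleftrightarrow>
     pair_digraph G \<and> (\<forall>u v. (u, v) \<in> parcs G \<longrightarrow> (v, u) \<notin> parcs G)"

definition labelled_digraphs :: "nat \<Rightarrow> nat pair_pre_digraph set" where
  "labelled_digraphs n = {G. pair_digraph G \<and> pverts G = {1..n}}"

definition labelled_oriented_graphs :: "nat \<Rightarrow> nat pair_pre_digraph set" where
  "labelled_oriented_graphs n = {G. oriented_graph G \<and> pverts G = {1..n}}"

definition T3 :: "nat pair_pre_digraph" where
  "T3 = \<lparr>pverts = {0, 1, 2}, parcs = {(0, 1), (1, 2), (0, 2)}\<rparr>"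

text \<open>The class \<open>S\<^sub>v\<close> replacing the vertex \<open>v\<close> is \<open>{v} \<times> {..<t}\<close>.\<close>

definition blow_up :: "'a pair_pre_digraph \<Rightarrow> nat \<Rightarrow> ('a \<times> nat) pair_pre_digraph" where
  "blow_up H t =
     \<lparr>pverts = pverts H \<times> {..<t},
      parcs = {((u, i), (v, j)) |u v i j. (u, v) \<in> parcs H \<and> i < t \<and> j < t}\<rparr>"

text \<open>Sub-digraphs need not be induced.\<close>

definition digraph_free :: "'b pair_pre_digraph \<Rightarrow> 'a pair_pre_digraph \<Rightarrow> bool" where
  "digraph_free H G \<longleftrightarrow>
     \<not> (\<exists>K. subgraph (with_proj K) (with_proj G) \<and> digraph_iso (with_proj H) (with_proj K))"

definition free_digraphs :: "nat \<Rightarrow> 'b pair_pre_digraph \<Rightarrow> nat pair_pre_digraph set" where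
  "free_digraphs n H = {G \<in> labelled_digraphs n. digraph_free H G}"

definition free_oriented_graphs :: "nat \<Rightarrow> 'b pair_pre_digraph \<Rightarrow> nat pair_pre_digraph set" where
  "free_oriented_graphs n H = {G \<in> labelled_oriented_graphs n. digraph_free H G}"

text \<open>\<open>f_oriented n H\<close> is \<open>f(n, H)\<close>, and \<open>f_digraph n H\<close> is \<open>f\<^sup>*(n, H)\<close>.\<close>

definition f_oriented :: "nat \<Rightarrow> 'b pair_pre_digraph \<Rightarrow> nat" where
  "f_oriented n H = card (free_oriented_graphs n H)"

definition f_digraph :: "nat \<Rightarrow> 'b pair_pre_digraph \<Rightarrow> nat" where
  "f_digraph n H = card (free_digraphs n H)"

text \<open>As in \<^theory>\<open>Graph_Theory.Digraph\<close>, an undirected graph is a symmetric digraph; the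
  underlying undirected graph of a digraph is its symmetric closure. An edge whose two ends lie
  in different classes is stated for both of its directions.\<close>

definition bipartite_graph :: "'a pair_pre_digraph \<Rightarrow> bool" where
  "bipartite_graph G \<longleftrightarrow>
     (\<exists>A B. pverts G = A \<union> B \<and> A \<inter> B = {} \<and>
        (\<forall>(u, v) \<in> parcs G. u \<in> A \<and> v \<in> B \<or> u \<in> B \<and> v \<in> A))"

definition bipartite_digraph :: "'a pair_pre_digraph \<Rightarrow> bool" where
  "bipartite_digraph G \<longleftrightarrow> bipartite_graph (mk_symmetric (with_proj G))"

text \<open>Each change inserts or deletes one edge. Reversing an edge counts as two changes, and the
  result of changing an oriented graph may be any digraph; neither convention affects the
  property below, because deleting from \<open>G\<close> the edges absent from \<open>G'\<close> already gives a
  bipartite digraph.\<close>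

definition bipartite_after_changes :: "real \<Rightarrow> 'a pair_pre_digraph \<Rightarrow> bool" where
  "bipartite_after_changes m G \<longleftrightarrow>
     (\<exists>G'. pair_digraph G' \<and> pverts G' = pverts G \<and> bipartite_digraph G' \<and>
        real (card (sym_diff (parcs G) (parcs G'))) \<le> m)"

end

(* Call (x, y, z) a transitive triple of D if xy, yz, xz are all arcs. A T3^t-free digraph on n
   vertices has o(n^3) transitive triples, by pigeonhole. Every digraph G with few transitive triples
   is covered, up to a small number of arcs, by one of 2^O(n) digraphs D that again have few
   transitive triples: D is the set of pairs on which a [0,1]-valued weighting w exceeds a
   threshold, and w is obtained from 0 by boundedly many corrections, each of which lowers the
   squared distance from w to G by a constant proportion of n^2 and can be described by O(n) bits.
   This replaces both the regularity lemma and hypergraph containers.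

   The number of oriented graphs (digraphs) inside D is 2^W, where W counts double edges of D with
   weight a = log_2 3 (respectively a = 2) and single edges with weight 1. A double edge xy lies in
   no triangle of the underlying graph of a T3-free digraph, so the weights from x and y to any
   third vertex add up to at most a. If W is close to a n^2/4, then some double edge xy attains
   this bound for almost all vertices; the neighbourhoods of x and y joined to them by double
   edges then give an almost bipartition. All other D contribute exponentially less than the
   3^(n^2/4) (respectively 4^(n^2/4)) bipartite graphs. *)

theory Submission
  imports Defs "HOL-Library.FuncSet"
begin

section \<open>Stability for digraphs with few transitive triangles\<close>

text \<open>The obstacle is the blow-up of a cyclic triangle: it spans no transitive triangle
  although its underlying graph is full of triangles. It has about n^2/3 single edges, and this
  weight stays below a n^2/4 exactly when a > 4/3. With 3/2 <= a the margin is a/2 - 2/3 >= 1/12;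
  sums run over ordered pairs, so every edge counts twice and a n^2/4 appears as a n^2/2.

  Stability is applied to the container D and never to G, since a sparse G satisfies no weight
  bound. A bipartition of D serves every G covered by D, at the cost of the arcs of G outside D.
  These arcs must be few for a second reason: besides a subset of D they are all that is needed to
  specify G.

  Containers have few transitive triples, not none. No removal lemma is used; averaging absorbs the
  exceptions inside the stability proof.

  The number of corrections is bounded because the squared distance starts at most n^2 and the step
  size depends only on the tolerances. So there are 2^O(n) containers, which is negligible against a
  gain of the form 2^(\<epsilon> n^2).\<close>

definition edge_weight :: "real \<Rightarrow> 'a rel \<Rightarrow> 'a \<Rightarrow> 'a \<Rightarrow> real" where
  "edge_weight a D x y =
     (if (x, y) \<in> D \<and> (y, x) \<in> D then a else if (x, y) \<in> D \<or> (y, x) \<in> D then 1 else 0)"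

definition transitive_triples :: "'a rel \<Rightarrow> ('a \<times> 'a \<times> 'a) set" where
  "transitive_triples D = {(x, y, z). (x, y) \<in> D \<and> (y, z) \<in> D \<and> (x, z) \<in> D}"

text \<open>Symmetric in the three vertices, unlike membership in \<open>transitive_triples\<close>,
  so one codegree per pair suffices. For irreflexive \<open>D\<close> no degenerate triple occurs: a
  repeated vertex would force a loop.\<close>

definition spans_T3 :: "'a rel \<Rightarrow> 'a \<Rightarrow> 'a \<Rightarrow> 'a \<Rightarrow> bool" where
  "spans_T3 D x y z \<longleftrightarrow>
     {(x, y, z), (x, z, y), (y, x, z), (y, z, x), (z, x, y), (z, y, x)} \<inter> transitive_triples D \<noteq> {}"

lemma edge_weight_sym: "edge_weight a D x y = edge_weight a D y x"
  by (auto simp: edge_weight_def)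

lemma real_card_filter: "finite S \<Longrightarrow> real (card {x \<in> S. P x}) = (\<Sum>x\<in>S. of_bool (P x))"
  by (simp add: of_bool_def sum.If_cases Int_def)

lemma markov_card:
  assumes "finite S" "\<And>x. x \<in> S \<Longrightarrow> 0 \<le> f x" "0 \<le> s"
  shows "s * real (card {x \<in> S. s < f x}) \<le> (\<Sum>x\<in>S. f x)"
proof -
  have "s * real (card {x \<in> S. s < f x}) = (\<Sum>x\<in>{x \<in> S. s < f x}. s)" by simp
  also have "\<dots> \<le> (\<Sum>x\<in>{x \<in> S. s < f x}. f x)" by (intro sum_mono) auto
  also have "\<dots> \<le> (\<Sum>x\<in>S. f x)" using assms by (intro sum_mono2) auto
  finally show ?thesis .
qed

lemma spans_T3_iff:
  "spans_T3 D x y z \<longleftrightarrow> (x, y, z) \<in> transitive_triples D \<or> (x, z, y) \<in> transitive_triples D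
     \<or> (y, x, z) \<in> transitive_triples D \<or> (y, z, x) \<in> transitive_triples D
     \<or> (z, x, y) \<in> transitive_triples D \<or> (z, y, x) \<in> transitive_triples D"
  by (simp add: spans_T3_def Int_insert_left)

lemma transitive_triples_iff [simp]:
  "(x, y, z) \<in> transitive_triples D \<longleftrightarrow> (x, y) \<in> D \<and> (y, z) \<in> D \<and> (x, z) \<in> D"
  by (simp add: transitive_triples_def)

lemma card_transitive_triples:
  assumes "finite V" "D \<subseteq> V \<times> V"
  shows "real (card (transitive_triples D))
       = (\<Sum>x\<in>V. \<Sum>y\<in>V. \<Sum>z\<in>V. of_bool ((x, y, z) \<in> transitive_triples D))"
proof -
  have "transitive_triples D = {q \<in> V \<times> V \<times> V. q \<in> transitive_triples D}"
    using assms by (auto simp: transitive_triples_def)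
  then have "real (card (transitive_triples D)) = real (card {q \<in> V \<times> V \<times> V. q \<in> transitive_triples D})"
    by (rule arg_cong)
  also have "\<dots> = (\<Sum>q\<in>V \<times> V \<times> V. of_bool (q \<in> transitive_triples D))"
    using assms by (intro real_card_filter) simp
  finally show ?thesis by (simp only: sum.cartesian_product split_def prod.collapse)
qed

lemma of_bool_disj_le: "(of_bool (P \<or> Q) :: real) \<le> of_bool P + of_bool Q"
  by simp

text \<open>A union bound over the six orders; renaming the summation variables makes all six sums
  equal.\<close>

lemma card_spans_T3_le:
  assumes "finite V" "D \<subseteq> V \<times> V"
  shows "(\<Sum>x\<in>V. \<Sum>y\<in>V. \<Sum>z\<in>V. of_bool (spans_T3 D x y z)) \<le> 6 * real (card (transitive_triples D))"
proof -
  define T :: "'a \<Rightarrow> 'a \<Rightarrow> 'a \<Rightarrow> real" where "T x y z = of_bool ((x, y, z) \<in> transitive_triples D)" for x y z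
  have sw: "(\<Sum>x\<in>V. \<Sum>y\<in>V. \<Sum>z\<in>V. f x z y) = (\<Sum>x\<in>V. \<Sum>y\<in>V. \<Sum>z\<in>V. f x y z)" for f :: "'a \<Rightarrow> 'a \<Rightarrow> 'a \<Rightarrow> real"
    by (intro sum.cong refl sum.swap)
  have sw': "(\<Sum>x\<in>V. \<Sum>y\<in>V. \<Sum>z\<in>V. f y x z) = (\<Sum>x\<in>V. \<Sum>y\<in>V. \<Sum>z\<in>V. f x y z)" for f :: "'a \<Rightarrow> 'a \<Rightarrow> 'a \<Rightarrow> real"
    by (rule sum.swap)
  have "(\<Sum>x\<in>V. \<Sum>y\<in>V. \<Sum>z\<in>V. of_bool (spans_T3 D x y z))
     \<le> (\<Sum>x\<in>V. \<Sum>y\<in>V. \<Sum>z\<in>V. T x y z + (T x z y + (T y x z + (T y z x + (T z x y + T z y x)))))"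
    unfolding T_def spans_T3_iff
    by (intro sum_mono order_trans[OF of_bool_disj_le] add_mono order_refl)
  also have "\<dots> = (\<Sum>x\<in>V. \<Sum>y\<in>V. \<Sum>z\<in>V. T x y z) + ((\<Sum>x\<in>V. \<Sum>y\<in>V. \<Sum>z\<in>V. T x z y)
      + ((\<Sum>x\<in>V. \<Sum>y\<in>V. \<Sum>z\<in>V. T y x z) + ((\<Sum>x\<in>V. \<Sum>y\<in>V. \<Sum>z\<in>V. T y z x)
      + ((\<Sum>x\<in>V. \<Sum>y\<in>V. \<Sum>z\<in>V. T z x y) + (\<Sum>x\<in>V. \<Sum>y\<in>V. \<Sum>z\<in>V. T z y x)))))"
    by (simp only: sum.distrib)
  also have "(\<Sum>x\<in>V. \<Sum>y\<in>V. \<Sum>z\<in>V. T z y x) = (\<Sum>x\<in>V. \<Sum>y\<in>V. \<Sum>z\<in>V. T y z x)"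
    by (rule sw)
  also have "(\<Sum>x\<in>V. \<Sum>y\<in>V. \<Sum>z\<in>V. T z x y) = (\<Sum>x\<in>V. \<Sum>y\<in>V. \<Sum>z\<in>V. T y x z)"
    by (rule sw)
  also have "(\<Sum>x\<in>V. \<Sum>y\<in>V. \<Sum>z\<in>V. T y z x) = (\<Sum>x\<in>V. \<Sum>y\<in>V. \<Sum>z\<in>V. T x z y)"
    by (rule sw')
  also have "(\<Sum>x\<in>V. \<Sum>y\<in>V. \<Sum>z\<in>V. T y x z) = (\<Sum>x\<in>V. \<Sum>y\<in>V. \<Sum>z\<in>V. T x y z)"
    by (rule sw')
  also have "(\<Sum>x\<in>V. \<Sum>y\<in>V. \<Sum>z\<in>V. T x z y) = (\<Sum>x\<in>V. \<Sum>y\<in>V. \<Sum>z\<in>V. T x y z)"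
    by (rule sw)
  finally show ?thesis unfolding T_def card_transitive_triples[OF assms, symmetric] by linarith
qed

text \<open>The square in \<open>\<delta>\<^sup>2\<close> pays for averaging: at most \<delta> n
  vertices have degree above \<delta> n^2, and at most \<delta> n^2 pairs have codegree above
  \<delta> n.\<close>

locale few_transitive_triangles =
  fixes V :: "'a set" and D :: "'a rel" and a \<delta> n :: real
  assumes finV: "finite V" and n_def: "n = real (card V)" and n_pos: "0 < n"
    and D_sub: "D \<subseteq> V \<times> V" and D_irrefl: "\<And>x. (x, x) \<notin> D"
    and a_ge: "3 / 2 \<le> a" and a_le: "a \<le> 2" and \<delta>_pos: "0 < \<delta>" and \<delta>_le: "\<delta> \<le> 1"
    and few: "(\<Sum>x\<in>V. \<Sum>y\<in>V. \<Sum>z\<in>V. of_bool (spans_T3 D x y z)) \<le> \<delta>\<^sup>2 * n ^ 3"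
begin

abbreviation "w \<equiv> edge_weight a D"
abbreviation "B \<equiv> spans_T3 D"

definition "codeg x y = (\<Sum>z\<in>V. of_bool (B x y z) :: real)"
definition "deg x = (\<Sum>y\<in>V. codeg x y)"

definition "double x y \<longleftrightarrow> (x, y) \<in> D \<and> (y, x) \<in> D"
definition "single x y \<longleftrightarrow> ((x, y) \<in> D) \<noteq> ((y, x) \<in> D)"
text \<open>The codegree bound limits the weight that \<open>x\<close> and \<open>y\<close> jointly
  send out. The degree bounds limit the arcs inside the sets joined to \<open>x\<close> or
  \<open>y\<close> by double edges.\<close>

definition "good x y \<longleftrightarrow> double x y \<and> codeg x y \<le> \<delta> * n \<and> deg x \<le> \<delta> * n\<^sup>2 \<and> deg y \<le> \<delta> * n\<^sup>2"

lemma codeg_nonneg: "0 \<le> codeg x y" by (simp add: codeg_def sum_nonneg)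
lemma deg_nonneg: "0 \<le> deg x" by (simp add: deg_def sum_nonneg codeg_nonneg)

lemma w_le: "w x y \<le> a" using a_ge by (simp add: edge_weight_def)

lemma w_eq: "w x y = a * of_bool (double x y) + of_bool (single x y)"
  by (auto simp: edge_weight_def double_def single_def)

text \<open>Whatever the directions of the arcs at \<open>z\<close>, one of the two directions of
  the double edge completes them to a transitive triangle.\<close>

lemma double_spans:
  assumes "double x y" "(x, z) \<in> D \<or> (z, x) \<in> D" "(y, z) \<in> D \<or> (z, y) \<in> D"
  shows "B x y z"
  using assms by (auto simp: double_def spans_T3_iff)

lemma double_sum_w_le:
  assumes "double x y"
  shows "w x z + w y z \<le> a + a * of_bool (B x y z)"
proof (cases "((x, z) \<in> D \<or> (z, x) \<in> D) \<and> ((y, z) \<in> D \<or> (z, y) \<in> D)")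
  case True
  then have "B x y z" using double_spans[OF assms] by blast
  then show ?thesis using w_le[of x z] w_le[of y z] by simp
next
  case False
  then have "w x z = 0 \<or> w y z = 0" by (auto simp: edge_weight_def)
  moreover have "a * of_bool (B x y z) \<ge> 0" using a_ge by simp
  ultimately show ?thesis using w_le[of x z] w_le[of y z] by linarith
qed

text \<open>Needed for arbitrary \<open>S\<close>: the greedy removal below uses it to bound the
  weight from removed pairs into a remainder that is not yet known.\<close>

lemma good_sum_w_le:
  assumes "good x y" "S \<subseteq> V"
  shows "(\<Sum>z\<in>S. w x z + w y z) \<le> a * real (card S) + 2 * \<delta> * n"
proof -
  have "(\<Sum>z\<in>S. w x z + w y z) \<le> (\<Sum>z\<in>S. a + a * of_bool (B x y z))"
    using assms by (intro sum_mono double_sum_w_le) (simp add: good_def)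
  also have "\<dots> = a * card S + a * (\<Sum>z\<in>S. of_bool (B x y z))"
    by (simp add: sum.distrib sum_distrib_left mult.commute)
  also have "(\<Sum>z\<in>S. of_bool (B x y z)) \<le> codeg x y"
    unfolding codeg_def using assms finV by (intro sum_mono2) auto
  also have "codeg x y \<le> \<delta> * n" using assms by (simp add: good_def)
  also have "a * (\<delta> * n) \<le> 2 * (\<delta> * n)" using a_le \<delta>_pos n_pos by (intro mult_right_mono) auto
  finally show ?thesis using a_ge by (simp add: mult_left_mono)
qed

text \<open>A double edge fails to be good for one of three reasons: the degree of \<open>x\<close>,
  the degree of \<open>y\<close>, or the codegree. Each accounts for at most \<delta> n^2 ordered
  pairs.\<close>

lemma sum_bad_double_le:
  "(\<Sum>x\<in>V. \<Sum>y\<in>V. of_bool (double x y \<and> \<not> good x y)) \<le> 3 * \<delta> * n\<^sup>2"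
proof -
  define h where "h = card {x \<in> V. \<delta> * n\<^sup>2 < deg x}"
  define k where "k = card {p \<in> V \<times> V. \<delta> * n < codeg (fst p) (snd p)}"
  have tot: "(\<Sum>x\<in>V. deg x) \<le> \<delta>\<^sup>2 * n ^ 3" using few by (simp add: deg_def codeg_def)
  have "\<delta> * n\<^sup>2 * h \<le> \<delta>\<^sup>2 * n ^ 3"
    unfolding h_def using tot \<delta>_pos n_pos
    by (intro order_trans[OF markov_card[OF finV]]) (auto simp: deg_nonneg)
  also have "\<dots> = \<delta> * n\<^sup>2 * (\<delta> * n)" by (simp add: power2_eq_square power3_eq_cube)
  finally have h: "h \<le> \<delta> * n" using \<delta>_pos n_pos by simp
  have "\<delta> * n * k \<le> (\<Sum>p\<in>V \<times> V. codeg (fst p) (snd p))"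
    unfolding k_def using \<delta>_pos n_pos finV by (intro markov_card) (auto simp: codeg_nonneg)
  also have "\<dots> = (\<Sum>x\<in>V. deg x)" by (simp add: deg_def sum.cartesian_product split_def)
  also have "\<dots> \<le> \<delta> * n * (\<delta> * n\<^sup>2)" using tot by (simp add: power2_eq_square power3_eq_cube mult_ac)
  finally have k: "k \<le> \<delta> * n\<^sup>2" using \<delta>_pos n_pos by simp
  have hs: "(\<Sum>x\<in>V. of_bool (\<delta> * n\<^sup>2 < deg x)) = real h"
    unfolding h_def by (rule real_card_filter[symmetric, OF finV])
  have ks: "(\<Sum>x\<in>V. \<Sum>y\<in>V. of_bool (\<delta> * n < codeg x y)) = real k"
    unfolding k_def using finV
    by (subst real_card_filter) (simp_all only: sum.cartesian_product split_def finite_cartesian_product)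
  have "(\<Sum>x\<in>V. \<Sum>y\<in>V. of_bool (double x y \<and> \<not> good x y))
     \<le> (\<Sum>x\<in>V. \<Sum>y\<in>V. of_bool (\<delta> * n\<^sup>2 < deg x) + of_bool (\<delta> * n\<^sup>2 < deg y) + of_bool (\<delta> * n < codeg x y) :: real)"
    by (intro sum_mono) (auto simp: good_def)
  also have "\<dots> = n * h + n * h + k"
    by (simp add: sum.distrib hs ks flip: sum_distrib_left sum_distrib_right n_def)
  also have "\<dots> \<le> n * (\<delta> * n) + n * (\<delta> * n) + \<delta> * n\<^sup>2"
    using h k n_pos by (intro add_mono mult_left_mono) auto
  finally show ?thesis by (simp add: power2_eq_square)
qed

text \<open>A triangle of three single edges that does not span a transitive triangle is cyclic, so a
  vertex \<open>x\<close> lies in at most \<open>d\<^sup>+(x) d\<^sup>-(x) \<le> d(x)\<^sup>2 / 4\<close> of them.\<close>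

lemma sum_single_le:
  assumes "R \<subseteq> V"
  shows "(\<Sum>x\<in>R. \<Sum>y\<in>R. of_bool (single x y)) \<le> 2 / 3 * (real (card R))\<^sup>2 + \<delta> * n\<^sup>2"
proof -
  let ?r = "real (card R)"
  define s :: "'a \<Rightarrow> 'a \<Rightarrow> real" where "s x y = of_bool (single x y)" for x y
  define I :: "'a \<Rightarrow> 'a \<Rightarrow> real" where "I x y = of_bool (single x y \<and> (y, x) \<in> D)" for x y
  define Q :: "'a \<Rightarrow> 'a \<Rightarrow> real" where "Q x y = of_bool (single x y \<and> (x, y) \<in> D)" for x y
  define d where "d x = (\<Sum>y\<in>R. s x y)" for x
  define E where "E = (\<Sum>x\<in>R. d x)"
  have finR: "finite R" using assms finV finite_subset by blast
  have ssym: "s x y = s y x" for x y by (auto simp: s_def single_def)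
  have s_split: "s x y = I x y + Q x y" for x y by (auto simp: s_def I_def Q_def single_def)
  \<comment> \<open>The left side is 2 only if all three pairs are single. Then either a transitive
    triangle is spanned, or the triangle is cyclic and \<open>x\<close> has one in-arc and one
    out-arc in it, so the last bracket is 1.\<close>
  have pt: "s x y * s x z + s x y * s y z \<le> s x y + of_bool (B x y z) + (I x y * Q x z + Q x y * I x z)"
    for x y z
    unfolding s_def I_def Q_def single_def spans_T3_iff transitive_triples_iff
    by (cases "(x, y) \<in> D"; cases "(y, x) \<in> D"; cases "(x, z) \<in> D"; cases "(z, x) \<in> D";
        cases "(y, z) \<in> D"; cases "(z, y) \<in> D"; simp)
  have cyc: "(\<Sum>y\<in>R. \<Sum>z\<in>R. I x y * Q x z + Q x y * I x z) \<le> (d x)\<^sup>2 / 2" for x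
  proof -
    define i q where "i = (\<Sum>y\<in>R. I x y)" and "q = (\<Sum>y\<in>R. Q x y)"
    have d: "d x = i + q" by (simp add: d_def s_split sum.distrib i_def q_def)
    have "(\<Sum>y\<in>R. \<Sum>z\<in>R. I x y * Q x z + Q x y * I x z) = 2 * i * q"
      by (simp add: sum.distrib i_def q_def flip: sum_distrib_left sum_distrib_right)
    moreover have "(i - q)\<^sup>2 \<ge> 0" by simp
    ultimately show ?thesis unfolding d by (simp add: power2_eq_square algebra_simps)
  qed
  have "(\<Sum>x\<in>R. \<Sum>y\<in>R. \<Sum>z\<in>R. s x y * s x z + s x y * s y z)
     \<le> (\<Sum>x\<in>R. \<Sum>y\<in>R. \<Sum>z\<in>R. s x y + of_bool (B x y z) + (I x y * Q x z + Q x y * I x z))"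
    by (intro sum_mono pt)
  also have "\<dots> = ?r * E + (\<Sum>x\<in>R. \<Sum>y\<in>R. \<Sum>z\<in>R. of_bool (B x y z))
      + (\<Sum>x\<in>R. \<Sum>y\<in>R. \<Sum>z\<in>R. I x y * Q x z + Q x y * I x z)"
    by (simp add: sum.distrib E_def d_def sum_distrib_left)
  also have "(\<Sum>x\<in>R. \<Sum>y\<in>R. \<Sum>z\<in>R. of_bool (B x y z)) \<le> (\<Sum>x\<in>V. \<Sum>y\<in>V. \<Sum>z\<in>V. of_bool (B x y z) :: real)"
    using assms finV
    by (intro order_trans[OF sum_mono[OF order_trans[OF sum_mono[OF sum_mono2] sum_mono2]] sum_mono2])
      (auto intro!: sum_nonneg)
  also note few
  also have "(\<Sum>x\<in>R. \<Sum>y\<in>R. \<Sum>z\<in>R. I x y * Q x z + Q x y * I x z) \<le> (\<Sum>x\<in>R. (d x)\<^sup>2 / 2)"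
    by (intro sum_mono cyc)
  also have "(\<Sum>x\<in>R. (d x)\<^sup>2 / 2) = (\<Sum>x\<in>R. (d x)\<^sup>2) / 2"
    by (rule sum_divide_distrib[symmetric])
  also have "(\<Sum>x\<in>R. \<Sum>y\<in>R. \<Sum>z\<in>R. s x y * s x z + s x y * s y z) = 2 * (\<Sum>x\<in>R. (d x)\<^sup>2)"
  proof -
    have "(\<Sum>x\<in>R. \<Sum>y\<in>R. \<Sum>z\<in>R. s x y * s x z) = (\<Sum>x\<in>R. (d x)\<^sup>2)"
      by (simp add: d_def power2_eq_square flip: sum_distrib_left sum_distrib_right)
    moreover have "(\<Sum>x\<in>R. \<Sum>y\<in>R. \<Sum>z\<in>R. s x y * s y z) = (\<Sum>y\<in>R. (d y)\<^sup>2)"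
      by (subst sum.swap) (simp add: d_def power2_eq_square ssym[of _ y for y] flip: sum_distrib_left sum_distrib_right)
    ultimately show ?thesis by (simp add: sum.distrib)
  qed
  finally have main: "3 / 2 * (\<Sum>x\<in>R. (d x)\<^sup>2) \<le> ?r * E + \<delta>\<^sup>2 * n ^ 3"
    by linarith
  \<comment> \<open>The degree in a balanced blow-up of a cyclic triangle, where the bound is tight.
    Expanding the squares around \<open>q\<close> gives the linear lower bound on the sum of squared
    degrees that is needed.\<close>
  define q where "q = 2 / 3 * ?r"
  have "0 \<le> (\<Sum>x\<in>R. (d x - q)\<^sup>2)" by (simp add: sum_nonneg)
  also have "\<dots> = (\<Sum>x\<in>R. (d x)\<^sup>2 + q\<^sup>2 - 2 * q * d x)"
    by (simp add: power2_diff mult_ac)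
  also have "\<dots> = (\<Sum>x\<in>R. (d x)\<^sup>2) + ?r * q\<^sup>2 - 2 * q * E"
    by (simp add: sum.distrib sum_subtractf E_def sum_distrib_left)
  also have "\<dots> = (\<Sum>x\<in>R. (d x)\<^sup>2) - 4 / 3 * (?r * E) + 4 / 9 * ?r ^ 3"
    by (simp add: q_def power2_eq_square power3_eq_cube)
  finally have "?r * E \<le> 2 / 3 * ?r ^ 3 + \<delta>\<^sup>2 * n ^ 3" using main by simp
  then have rE: "?r * E \<le> ?r * (2 / 3 * ?r\<^sup>2) + (\<delta> * n) * (\<delta> * n\<^sup>2)"
    by (simp add: power2_eq_square power3_eq_cube algebra_simps)
  have "E \<le> 2 / 3 * ?r\<^sup>2 + \<delta> * n\<^sup>2"
  \<comment> \<open>Dividing by \<open>card R\<close> keeps the error below \<delta> n^2 only if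
    \<open>R\<close> is not tiny; for tiny \<open>R\<close> the trivial bound on the number of pairs
    is enough.\<close>
  proof (cases "\<delta> * n \<le> ?r")
    case True
    have "(\<delta> * n) * (\<delta> * n\<^sup>2) \<le> ?r * (\<delta> * n\<^sup>2)" using True \<delta>_pos by (intro mult_right_mono) auto
    then have "?r * E \<le> ?r * (2 / 3 * ?r\<^sup>2 + \<delta> * n\<^sup>2)" using rE by (simp add: distrib_left)
    moreover have "0 < ?r" using True \<delta>_pos n_pos by (intro less_le_trans[OF _ True]) simp
    ultimately show ?thesis by simp
  next
    case False
    have "E \<le> (\<Sum>x\<in>R. \<Sum>y\<in>R. 1)" unfolding E_def d_def s_def by (intro sum_mono) auto
    then have "E \<le> ?r * ?r" by simp
    also have "\<dots> \<le> (\<delta> * n) * (\<delta> * n)" using False by (intro mult_mono) auto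
    also have "\<dots> = \<delta>\<^sup>2 * n\<^sup>2" by (simp add: power2_eq_square)
    also have "\<dots> \<le> \<delta> * n\<^sup>2" using \<delta>_pos \<delta>_le by (intro mult_right_mono) (auto simp: power2_eq_square)
    finally show ?thesis by (simp add: add_increasing)
  qed
  then show ?thesis by (simp add: E_def d_def s_def)
qed

text \<open>Good double edges are removed greedily. The remaining set \<open>R\<close> carries almost only single
  edges, so its density is at most \<open>2/3 < a/2\<close>; if every good double edge had a small degree
  sum, the total weight would be too small as well.\<close>

lemma exists_tight_good:
  assumes e: "0 < e" "e \<le> 1 / 12" "\<delta> \<le> e / 100"
    and heavy: "(a / 2 - e / 8) * n\<^sup>2 \<le> (\<Sum>x\<in>V. \<Sum>y\<in>V. w x y)"
  shows "\<exists>x\<in>V. \<exists>y\<in>V. good x y \<and> (a - e) * n < (\<Sum>z\<in>V. w x z + w y z)"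
proof (rule ccontr)
  assume "\<not> ?thesis"
  then have low: "(\<Sum>z\<in>V. w x z + w y z) \<le> (a - e) * n" if "good x y" "x \<in> V" "y \<in> V" for x y
    using that by (meson not_less)
  \<comment> \<open>\<open>V - R\<close> stands for the union of disjoint good double edges already
    removed, so half its size counts them. The last clause speaks of all \<open>S\<close> because it
    will be used for \<open>S = R\<close> with the final \<open>R\<close>.\<close>
  define J where "J R \<longleftrightarrow> R \<subseteq> V
      \<and> (\<Sum>x\<in>V - R. \<Sum>z\<in>V. w x z) \<le> real (card (V - R)) / 2 * ((a - e) * n)
      \<and> (\<forall>S\<subseteq>V. (\<Sum>x\<in>V - R. \<Sum>z\<in>S. w x z) \<le> real (card (V - R)) / 2 * (a * card S + 2 * \<delta> * n))" for R
  have "J V" by (simp add: J_def)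
  \<comment> \<open>A smallest \<open>R\<close> replaces running the greedy procedure: a good pair
    left inside it could still be removed.\<close>
  then obtain R where J: "J R" and Rmin: "\<And>R'. J R' \<Longrightarrow> card R \<le> card R'"
    using ex_has_least_nat[of J V card] by blast
  have RV: "R \<subseteq> V" and finR: "finite R"
    using J finV finite_subset unfolding J_def by blast+
  have nogood: "\<not> good x y" if xy: "x \<in> R" "y \<in> R" for x y
  proof
    assume g: "good x y"
    then have ne: "x \<noteq> y" using D_irrefl by (auto simp: good_def double_def)
    have split: "V - (R - {x, y}) = insert x (insert y (V - R))" using xy RV by auto
    have xyV: "x \<in> V" "y \<in> V" "x \<notin> V - R" "y \<notin> V - R" using xy RV by auto
    have c: "real (card (V - (R - {x, y}))) = real (card (V - R)) + 2"
      unfolding split using ne xyV finV by simp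
    have sm: "(\<Sum>u\<in>V - (R - {x, y}). \<Sum>z\<in>S. w u z) = (\<Sum>u\<in>V - R. \<Sum>z\<in>S. w u z) + (\<Sum>z\<in>S. w x z + w y z)" for S
      unfolding split using ne xyV finV by (simp add: sum.distrib)
    have "J (R - {x, y})"
      unfolding J_def c sm
    proof (intro conjI allI impI)
      show "R - {x, y} \<subseteq> V" using RV by auto
      show "(\<Sum>u\<in>V - R. \<Sum>z\<in>V. w u z) + (\<Sum>z\<in>V. w x z + w y z) \<le> (real (card (V - R)) + 2) / 2 * ((a - e) * n)"
        using J low[OF g xyV(1,2)] unfolding J_def by (simp add: field_simps)
      show "(\<Sum>u\<in>V - R. \<Sum>z\<in>S. w u z) + (\<Sum>z\<in>S. w x z + w y z)
          \<le> (real (card (V - R)) + 2) / 2 * (a * real (card S) + 2 * \<delta> * n)" if "S \<subseteq> V" for S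
      proof -
        have "(\<Sum>u\<in>V - R. \<Sum>z\<in>S. w u z) \<le> real (card (V - R)) / 2 * (a * real (card S) + 2 * \<delta> * n)"
          using J that unfolding J_def by blast
        then show ?thesis using good_sum_w_le[OF g that] by (simp add: field_simps)
      qed
    qed
    then have "card R \<le> card (R - {x, y})" by (rule Rmin)
    moreover have "card (R - {x, y}) < card R" using xy finR by (intro psubset_card_mono) auto
    ultimately show False by simp
  qed
  define \<rho> where "\<rho> = real (card R) / n"
  have \<rho>: "0 \<le> \<rho>" "\<rho> \<le> 1" "real (card R) = \<rho> * n"
    using n_pos card_mono[OF finV RV] by (auto simp: \<rho>_def n_def)
  have cVR: "real (card (V - R)) = (1 - \<rho>) * n"
    using RV finV \<rho>(3) card_mono[OF finV RV] by (simp add: card_Diff_subset finR of_nat_diff n_def algebra_simps)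
  have "(\<Sum>x\<in>R. \<Sum>y\<in>R. w x y)
      \<le> (\<Sum>x\<in>R. \<Sum>y\<in>R. of_bool (single x y) + a * of_bool (double x y \<and> \<not> good x y))"
    using nogood by (intro sum_mono) (auto simp: w_eq)
  also have "\<dots> = (\<Sum>x\<in>R. \<Sum>y\<in>R. of_bool (single x y)) + a * (\<Sum>x\<in>R. \<Sum>y\<in>R. of_bool (double x y \<and> \<not> good x y))"
    by (simp only: sum.distrib sum_distrib_left)
  also have "(\<Sum>x\<in>R. \<Sum>y\<in>R. of_bool (single x y)) \<le> 2 / 3 * (\<rho> * n)\<^sup>2 + \<delta> * n\<^sup>2"
    using sum_single_le[OF RV] \<rho>(3) by simp
  also have "(\<Sum>x\<in>R. \<Sum>y\<in>R. of_bool (double x y \<and> \<not> good x y))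
      \<le> (\<Sum>x\<in>V. \<Sum>y\<in>V. of_bool (double x y \<and> \<not> good x y) :: real)"
    using RV finV by (intro order_trans[OF sum_mono[OF sum_mono2] sum_mono2]) (auto intro: sum_nonneg)
  also have "\<dots> \<le> 3 * \<delta> * n\<^sup>2" by (rule sum_bad_double_le)
  also have "a * (3 * \<delta> * n\<^sup>2) \<le> 2 * (3 * \<delta> * n\<^sup>2)"
    using a_le \<delta>_pos by (intro mult_right_mono) auto
  finally have RR: "(\<Sum>x\<in>R. \<Sum>y\<in>R. w x y) \<le> 2 / 3 * (\<rho> * n)\<^sup>2 + 7 * \<delta> * n\<^sup>2"
    using a_ge by (simp add: mult_left_mono)
  have "(\<Sum>x\<in>R. \<Sum>y\<in>V - R. w x y) = (\<Sum>x\<in>V - R. \<Sum>y\<in>R. w x y)"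
    by (subst sum.swap) (simp add: edge_weight_sym)
  also have "\<dots> \<le> (1 - \<rho>) * n / 2 * (a * (\<rho> * n) + 2 * \<delta> * n)"
    using J RV unfolding J_def cVR \<rho>(3)[symmetric] by blast
  finally have RVR: "(\<Sum>x\<in>R. \<Sum>y\<in>V - R. w x y) \<le> (1 - \<rho>) * n / 2 * (a * (\<rho> * n) + 2 * \<delta> * n)" .
  have VRV: "(\<Sum>x\<in>V - R. \<Sum>y\<in>V. w x y) \<le> (1 - \<rho>) * n / 2 * ((a - e) * n)"
    using J unfolding J_def cVR by blast
  have "(\<Sum>x\<in>V. \<Sum>y\<in>V. w x y) = (\<Sum>x\<in>V - R. \<Sum>y\<in>V. w x y) + (\<Sum>x\<in>R. \<Sum>y\<in>V. w x y)"
    using RV finV by (rule sum.subset_diff)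
  also have "(\<Sum>x\<in>R. \<Sum>y\<in>V. w x y) = (\<Sum>x\<in>R. \<Sum>y\<in>V - R. w x y) + (\<Sum>x\<in>R. \<Sum>y\<in>R. w x y)"
    using sum.subset_diff[OF RV finV, of "w x" for x] by (simp add: sum.distrib)
  finally have "(a / 2 - e / 8) * n\<^sup>2 \<le> (1 - \<rho>) * n / 2 * ((a - e) * n)
      + ((1 - \<rho>) * n / 2 * (a * (\<rho> * n) + 2 * \<delta> * n) + (2 / 3 * (\<rho> * n)\<^sup>2 + 7 * \<delta> * n\<^sup>2))"
    using heavy RR RVR VRV by linarith
  also have "\<dots> = ((1 - \<rho>) * (a - e) / 2 + (1 - \<rho>) / 2 * (a * \<rho> + 2 * \<delta>) + 2 / 3 * \<rho>\<^sup>2 + 7 * \<delta>) * n\<^sup>2"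
    by (simp add: power2_eq_square algebra_simps)
  finally have "a / 2 - e / 8 \<le> (1 - \<rho>) * (a - e) / 2 + (1 - \<rho>) / 2 * (a * \<rho> + 2 * \<delta>) + 2 / 3 * \<rho>\<^sup>2 + 7 * \<delta>"
    using n_pos by simp
  \<comment> \<open>In the multiples of \<open>a\<close> the linear terms in \<rho> cancel, so a
    large remainder loses quadratically, while a small remainder loses through the factor e (1 -
    \<rho>).\<close>
  also have "\<dots> = a / 2 - (a / 2 - 2 / 3) * \<rho>\<^sup>2 - e * (1 - \<rho>) / 2 + 8 * \<delta> - \<rho> * \<delta>"
    by (simp add: field_simps power2_eq_square)
  also have "\<dots> \<le> a / 2 - e * \<rho>\<^sup>2 - e * (1 - \<rho>) / 2 + 8 * \<delta>"
  proof -
    \<comment> \<open>Origin of the bound 1/12 on \<open>e\<close>: it is the value of a/2 - 2/3 at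
      a = 3/2.\<close>
    have "e * \<rho>\<^sup>2 \<le> (a / 2 - 2 / 3) * \<rho>\<^sup>2" using a_ge e by (intro mult_right_mono) auto
    moreover have "0 \<le> \<rho> * \<delta>" using \<rho> \<delta>_pos by simp
    ultimately show ?thesis by linarith
  qed
  \<comment> \<open>Completing the square: \<rho>^2 + (1 - \<rho>)/2 is at least 7/16, and 7/16 -
    8/100 exceeds the allowed deficit 1/8.\<close>
  also have "\<dots> = a / 2 - e * (7 / 16 + (\<rho> - 1 / 4)\<^sup>2) + 8 * \<delta>"
    by (simp add: field_simps power2_eq_square)
  also have "\<dots> \<le> a / 2 - e * (7 / 16) + 8 * \<delta>"
    using e by simp
  finally show False using e by simp
qed

text \<open>For a tight good pair, almost every vertex must send full weight to one end, hence be
  joined to it by a double edge. The set \<open>X\<close> belonging to one end is the required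
  side.\<close>

lemma exists_bipartition:
  assumes e: "0 < e" "e \<le> 1 / 12" "\<delta> \<le> e / 100"
    and heavy: "(a / 2 - e / 8) * n\<^sup>2 \<le> (\<Sum>x\<in>V. \<Sum>y\<in>V. w x y)"
  shows "\<exists>A\<subseteq>V. real (card {(u, v) \<in> D. u \<in> A \<longleftrightarrow> v \<in> A}) \<le> 5 * e * n\<^sup>2"
proof -
  obtain x y where xy: "x \<in> V" "y \<in> V" "good x y" and tight: "(a - e) * n < (\<Sum>z\<in>V. w x z + w y z)"
    using exists_tight_good[OF assms] by blast
  have dbl: "double x y" using xy by (simp add: good_def)
  define X where "X = {z \<in> V. double x z \<and> \<not> B x y z}"
  define Y where "Y = {z \<in> V. double y z \<and> \<not> B x y z}"
  define C where "C = V - X - Y"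
  \<comment> \<open>Outside the spanned triangles one of the two weights vanishes; for
    \<open>z\<close> in \<open>C\<close> the other is at most 1, which is at most a - 1/2. So every
    such vertex of \<open>C\<close> costs 1/2.\<close>
  have pt: "w x z + w y z \<le> a - of_bool (z \<in> C) / 2 + (a + 1) * of_bool (B x y z)" if "z \<in> V" for z
  proof (cases "B x y z")
    case True
    then show ?thesis using w_le[of x z] w_le[of y z] by simp
  next
    case False
    then have "\<not> (((x, z) \<in> D \<or> (z, x) \<in> D) \<and> ((y, z) \<in> D \<or> (z, y) \<in> D))"
      using double_spans[OF dbl] by blast
    then show ?thesis using False that a_ge
      by (auto simp: C_def X_def Y_def w_eq double_def single_def)
  qed
  have finC: "finite C" "C \<subseteq> V" using finV by (auto simp: C_def)
  have "(\<Sum>z\<in>V. w x z + w y z) \<le> (\<Sum>z\<in>V. a - of_bool (z \<in> C) / 2 + (a + 1) * of_bool (B x y z))"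
    by (intro sum_mono pt)
  also have "\<dots> = a * n - real (card C) / 2 + (a + 1) * codeg x y"
  proof -
    have "(\<Sum>z\<in>V. of_bool (z \<in> C) / 2 :: real) = (\<Sum>z\<in>V. of_bool (z \<in> C)) / 2"
      by (rule sum_divide_distrib[symmetric])
    also have "(\<Sum>z\<in>V. of_bool (z \<in> C) :: real) = real (card {z \<in> V. z \<in> C})"
      by (rule real_card_filter[symmetric, OF finV])
    also have "{z \<in> V. z \<in> C} = C" using finC by auto
    finally show ?thesis
      unfolding codeg_def sum.distrib sum_subtractf sum_distrib_left by (simp add: n_def)
  qed
  also have "(a + 1) * codeg x y \<le> 3 * (\<delta> * n)"
    using xy a_le a_ge \<delta>_pos n_pos by (intro mult_mono) (auto simp: good_def codeg_nonneg)
  finally have "(a - e) * n < a * n - real (card C) / 2 + 3 * (\<delta> * n)" using tight by linarith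
  then have cC: "real (card C) \<le> (2 * e + 6 * \<delta>) * n" by (simp add: algebra_simps)
  \<comment> \<open>An arc between two vertices that are both doubly joined to \<open>p\<close>
    spans a transitive triangle with \<open>p\<close>, so such arcs are counted by
    \<open>deg p\<close>.\<close>
  have inner: "real (card {(u, v) \<in> D. u \<in> Z \<and> v \<in> Z}) \<le> \<delta> * n\<^sup>2"
    if Z: "Z \<subseteq> V" "\<And>z. z \<in> Z \<Longrightarrow> double p z" "deg p \<le> \<delta> * n\<^sup>2" for p Z
  proof -
    have "{(u, v) \<in> D. u \<in> Z \<and> v \<in> Z} \<subseteq> {q \<in> V \<times> V. B p (fst q) (snd q)}"
      using Z(1,2) by (force simp: double_def spans_T3_iff)
    then have "real (card {(u, v) \<in> D. u \<in> Z \<and> v \<in> Z}) \<le> real (card {q \<in> V \<times> V. B p (fst q) (snd q)})"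
      using finV by (intro of_nat_mono card_mono) auto
    also have "\<dots> = (\<Sum>q\<in>V \<times> V. of_bool (B p (fst q) (snd q)))"
      using finV by (intro real_card_filter) simp
    also have "\<dots> = deg p" by (simp only: deg_def codeg_def sum.cartesian_product split_def)
    finally show ?thesis using Z(3) by linarith
  qed
  have iX: "real (card {(u, v) \<in> D. u \<in> X \<and> v \<in> X}) \<le> \<delta> * n\<^sup>2"
    using xy by (intro inner[of X x]) (auto simp: X_def good_def)
  have iY: "real (card {(u, v) \<in> D. u \<in> Y \<and> v \<in> Y}) \<le> \<delta> * n\<^sup>2"
    using xy by (intro inner[of Y y]) (auto simp: Y_def good_def)
  have "{(u, v) \<in> D. u \<in> X \<longleftrightarrow> v \<in> X}
     \<subseteq> {(u, v) \<in> D. u \<in> X \<and> v \<in> X} \<union> {(u, v) \<in> D. u \<in> Y \<and> v \<in> Y} \<union> (C \<times> V \<union> V \<times> C)" (is "?L \<subseteq> ?M")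
    using D_sub by (auto simp: C_def)
  moreover have "finite ?M"
    by (rule finite_subset[of _ "V \<times> V"]) (use D_sub finC finV in \<open>auto simp: X_def Y_def\<close>)
  ultimately have "card ?L \<le> card ?M" by (intro card_mono)
  also have "\<dots> \<le> card {(u, v) \<in> D. u \<in> X \<and> v \<in> X} + card {(u, v) \<in> D. u \<in> Y \<and> v \<in> Y} + (card (C \<times> V) + card (V \<times> C))"
    by (intro order_trans[OF card_Un_le] add_mono card_Un_le order_refl)
  finally have "real (card ?L) \<le> real (card {(u, v) \<in> D. u \<in> X \<and> v \<in> X})
      + real (card {(u, v) \<in> D. u \<in> Y \<and> v \<in> Y}) + (real (card (C \<times> V)) + real (card (V \<times> C)))"
    by (simp only: of_nat_add[symmetric] of_nat_le_iff)
  also have "\<dots> \<le> \<delta> * n\<^sup>2 + \<delta> * n\<^sup>2 + 2 * (real (card C) * n)"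
    using iX iY by (simp add: card_cartesian_product n_def)
  also have "\<dots> \<le> \<delta> * n\<^sup>2 + \<delta> * n\<^sup>2 + 2 * (((2 * e + 6 * \<delta>) * n) * n)"
    using cC n_pos by (intro add_mono mult_mono mult_left_mono mult_right_mono) auto
  also have "\<dots> = (4 * e + 14 * \<delta>) * n\<^sup>2" by (simp add: power2_eq_square algebra_simps)
  also have "\<dots> \<le> (5 * e) * n\<^sup>2" using e by (intro mult_right_mono) auto
  finally show ?thesis by (intro exI[of _ X]) (auto simp: X_def)
qed

end

theorem transitive_triangle_stability:
  fixes V :: "'a set" and a \<beta> :: real
  assumes "3 / 2 \<le> a" "a \<le> 2" "0 < \<beta>"
  shows "\<exists>\<epsilon>>0. \<exists>\<eta>>0. \<forall>(V :: 'a set) D. finite V \<longrightarrow> V \<noteq> {} \<longrightarrow> D \<subseteq> V \<times> V \<longrightarrow> (\<forall>x. (x, x) \<notin> D)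
     \<longrightarrow> real (card (transitive_triples D)) \<le> \<eta> * real (card V) ^ 3
     \<longrightarrow> (a / 2 - \<epsilon>) * (real (card V))\<^sup>2 \<le> (\<Sum>x\<in>V. \<Sum>y\<in>V. edge_weight a D x y)
     \<longrightarrow> (\<exists>A\<subseteq>V. real (card {(u, v) \<in> D. u \<in> A \<longleftrightarrow> v \<in> A}) \<le> \<beta> * (real (card V))\<^sup>2)"
proof -
  \<comment> \<open>The term \<beta>/5 matches the 5 e n^2 of \<open>exists_bipartition\<close>.
    Below, \<open>\<delta>\<^sup>2 / 6\<close> serves as \<open>\<eta>\<close>, since each
    transitive triple may be counted in six orders.\<close>
  define e where "e = min (1 / 12) (\<beta> / 5)"
  define \<delta> where "\<delta> = e / 100"
  have e: "0 < e" "e \<le> 1 / 12" "5 * e \<le> \<beta>" and \<delta>: "0 < \<delta>" "\<delta> \<le> 1"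
    using assms by (auto simp: e_def \<delta>_def)
  show ?thesis
  proof (rule exI[of _ "e / 8"], rule conjI[OF _ exI[of _ "\<delta>\<^sup>2 / 6"]], goal_cases)
    case 2
    show ?case
    proof (intro conjI allI impI)
      fix V :: "'a set" and D
      assume A: "finite V" "V \<noteq> {}" "D \<subseteq> V \<times> V" "\<forall>x. (x, x) \<notin> D"
        and few: "real (card (transitive_triples D)) \<le> \<delta>\<^sup>2 / 6 * real (card V) ^ 3"
        and heavy: "(a / 2 - e / 8) * (real (card V))\<^sup>2 \<le> (\<Sum>x\<in>V. \<Sum>y\<in>V. edge_weight a D x y)"
      have "(\<Sum>x\<in>V. \<Sum>y\<in>V. \<Sum>z\<in>V. of_bool (spans_T3 D x y z)) \<le> 6 * real (card (transitive_triples D))"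
        using A by (intro card_spans_T3_le) auto
      also have "\<dots> \<le> \<delta>\<^sup>2 * real (card V) ^ 3" using few by simp
      finally have few': "(\<Sum>x\<in>V. \<Sum>y\<in>V. \<Sum>z\<in>V. of_bool (spans_T3 D x y z)) \<le> \<delta>\<^sup>2 * real (card V) ^ 3" .
      interpret few_transitive_triangles V D a \<delta> "real (card V)"
        by unfold_locales (use A assms \<delta> few' in \<open>simp_all add: card_gt_0_iff\<close>)
      obtain A where "A \<subseteq> V" "real (card {(u, v) \<in> D. u \<in> A \<longleftrightarrow> v \<in> A}) \<le> 5 * e * (real (card V))\<^sup>2"
        using exists_bipartition[OF e(1,2) _ heavy] by (auto simp: \<delta>_def)
      moreover have "5 * e * (real (card V))\<^sup>2 \<le> \<beta> * (real (card V))\<^sup>2"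
        using e by (intro mult_right_mono) auto
      ultimately show "\<exists>A\<subseteq>V. real (card {(u, v) \<in> D. u \<in> A \<longleftrightarrow> v \<in> A}) \<le> \<beta> * (real (card V))\<^sup>2"
        by (meson order_trans)
    qed (use \<delta> in auto)
  qed (use e in auto)
qed

section \<open>Containers\<close>

definition clip :: "real \<Rightarrow> real" where
  "clip r = max 0 (min 1 r)"

text \<open>If \<open>w\<close> has many more (weighted) transitive triples than \<open>G\<close>, then a telescoping sum over the
  three arcs shows that \<open>w\<close> exceeds \<open>G\<close> on average along one of the first three kinds of direction;
  if \<open>G\<close> has many arcs of weight at most \<open>\<gamma>\<close>, then \<open>G\<close> exceeds \<open>w\<close> along the last one.\<close>

definition directions :: "'a set \<Rightarrow> real \<Rightarrow> ('a \<Rightarrow> 'a \<Rightarrow> real) \<Rightarrow> ('a \<Rightarrow> 'a \<Rightarrow> real) set" where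
  "directions V \<gamma> w =
     (\<lambda>z x y. - (w y z * w x z)) ` V
     \<union> (\<lambda>(u, A) y z. - (of_bool (y \<in> A) * w u z)) ` (V \<times> Pow V)
     \<union> (\<lambda>(A, B) x z. - (of_bool (x \<in> A) * of_bool (z \<in> B))) ` (Pow V \<times> Pow V)
     \<union> {\<lambda>x y. of_bool (w x y \<le> \<gamma>)}"

text \<open>Each level contains the previous one, so a weighting reached early remains available at
  the last level.\<close>

primrec weightings :: "'a set \<Rightarrow> real \<Rightarrow> real \<Rightarrow> nat \<Rightarrow> ('a \<Rightarrow> 'a \<Rightarrow> real) set" where
  "weightings V \<gamma> c 0 = {\<lambda>_ _. 0}"
| "weightings V \<gamma> c (Suc k) = weightings V \<gamma> c k
     \<union> (\<Union>w\<in>weightings V \<gamma> c k. (\<lambda>h x y. clip (w x y + c * h x y)) ` directions V \<gamma> w)"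

definition heavy_pairs :: "'a set \<Rightarrow> real \<Rightarrow> ('a \<Rightarrow> 'a \<Rightarrow> real) \<Rightarrow> 'a rel" where
  "heavy_pairs V \<gamma> w = {(x, y) \<in> V \<times> V. x \<noteq> y \<and> \<gamma> < w x y}"

lemma finite_directions: "finite V \<Longrightarrow> finite (directions V \<gamma> w)"
  by (simp add: directions_def)

lemma card_directions:
  assumes "finite V"
  shows "card (directions V \<gamma> w) \<le> 4 * 4 ^ card V"
proof -
  let ?n = "card V"
  have "card (directions V \<gamma> w) \<le> card V + card (V \<times> Pow V) + card (Pow V \<times> Pow V) + 1"
    unfolding directions_def using assms
    by (intro order_trans[OF card_Un_le] add_mono card_image_le) auto
  also have "\<dots> = ?n + ?n * 2 ^ ?n + 2 ^ ?n * 2 ^ ?n + 1"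
    using assms by (simp add: card_cartesian_product card_Pow)
  also have "\<dots> \<le> 2 ^ ?n * 2 ^ ?n + 2 ^ ?n * 2 ^ ?n + 2 ^ ?n * 2 ^ ?n + 2 ^ ?n * 2 ^ ?n"
  proof (intro add_mono mult_right_mono order_refl)
    show le: "?n \<le> 2 ^ ?n" by (rule less_imp_le) (rule less_exp)
    show "?n \<le> 2 ^ ?n * 2 ^ ?n" using le by (rule order_trans) simp
  qed auto
  also have "\<dots> = 4 * 4 ^ ?n" by (simp flip: power_mult_distrib)
  finally show ?thesis .
qed

text \<open>One level multiplies the count by at most 1 + 4 * 4^n <= 2^(2n+3), where the 1 stands
  for making no correction.\<close>

lemma finite_card_weightings:
  assumes "finite V"
  shows "finite (weightings V \<gamma> c k) \<and> card (weightings V \<gamma> c k) \<le> 2 ^ ((2 * card V + 3) * k)"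
proof (induction k)
  case (Suc k)
  let ?W = "weightings V \<gamma> c k" and ?N = "2 * card V + 3"
  let ?f = "\<lambda>w. (\<lambda>h x y. clip (w x y + c * h x y)) ` directions V \<gamma> w"
  have fin: "finite (?f w)" for w using assms by (simp add: finite_directions)
  have "card (\<Union>w\<in>?W. ?f w) \<le> (\<Sum>w\<in>?W. card (?f w))"
    using Suc by (intro card_UN_le) simp
  also have "\<dots> \<le> (\<Sum>w\<in>?W. 4 * 4 ^ card V)"
    using assms by (intro sum_mono order_trans[OF card_image_le card_directions] finite_directions)
  finally have "card (weightings V \<gamma> c (Suc k)) \<le> card ?W + card ?W * (4 * 4 ^ card V)"
    by (simp add: order_trans[OF card_Un_le])
  also have "\<dots> = card ?W * (1 + 4 * 4 ^ card V)" by simp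
  also have "\<dots> \<le> 2 ^ (?N * k) * 2 ^ ?N"
  proof (intro mult_mono)
    have "(1::nat) \<le> 4 ^ card V" by simp
    then have "1 + 4 * 4 ^ card V \<le> (8::nat) * 4 ^ card V" by linarith
    also have "\<dots> = 2 ^ ?N" by (simp add: power_add power_mult)
    finally show "1 + 4 * 4 ^ card V \<le> (2::nat) ^ ?N" .
  qed (use Suc in auto)
  also have "\<dots> = 2 ^ (?N * Suc k)" by (simp add: power_add)
  finally show ?case using Suc fin by simp
qed simp

lemma weightings_range:
  "w \<in> weightings V \<gamma> c k \<Longrightarrow> 0 \<le> w x y \<and> w x y \<le> 1"
  by (induction k arbitrary: w) (auto simp: clip_def)

lemma directions_abs_le:
  assumes "\<And>x y. 0 \<le> w x y \<and> w x y \<le> 1" "h \<in> directions V \<gamma> w"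
  shows "\<bar>h x y\<bar> \<le> 1"
  using assms by (auto simp: directions_def abs_mult mult_le_one)

text \<open>Expanding the square, a step of size \<open>c\<close> along \<open>h\<close> costs at
  most c^2 n^2 and gains 2c times the correlation, hence at least 2 c^2 n^2. Clipping only helps,
  because \<open>g\<close> takes values in the unit interval.\<close>

lemma energy_decrement:
  assumes V: "finite V"
    and g: "\<And>x y. 0 \<le> g x y \<and> g x y \<le> (1::real)"
    and h: "\<And>x y. \<bar>h x y\<bar> \<le> 1"
    and c: "0 \<le> c"
    and corr: "c * (real (card V))\<^sup>2 \<le> (\<Sum>x\<in>V. \<Sum>y\<in>V. (g x y - w x y) * h x y)"
  shows "(\<Sum>x\<in>V. \<Sum>y\<in>V. (g x y - clip (w x y + c * h x y))\<^sup>2)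
       \<le> (\<Sum>x\<in>V. \<Sum>y\<in>V. (g x y - w x y)\<^sup>2) - c\<^sup>2 * (real (card V))\<^sup>2"
proof -
  have "(\<Sum>x\<in>V. \<Sum>y\<in>V. (g x y - clip (w x y + c * h x y))\<^sup>2)
      \<le> (\<Sum>x\<in>V. \<Sum>y\<in>V. (g x y - w x y)\<^sup>2 + c\<^sup>2 - 2 * c * ((g x y - w x y) * h x y))"
  proof (intro sum_mono)
    fix x y
    have "(g x y - clip (w x y + c * h x y))\<^sup>2 \<le> (g x y - (w x y + c * h x y))\<^sup>2"
      using g[of x y] by (intro abs_le_square_iff[THEN iffD1]) (auto simp: clip_def)
    also have "\<dots> = (g x y - w x y)\<^sup>2 + c\<^sup>2 * (h x y)\<^sup>2 - 2 * c * ((g x y - w x y) * h x y)"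
      by (simp add: power2_eq_square algebra_simps)
    also have "c\<^sup>2 * (h x y)\<^sup>2 \<le> c\<^sup>2 * 1"
      using h[of x y] by (intro mult_left_mono) (auto simp: abs_square_le_1)
    finally show "(g x y - clip (w x y + c * h x y))\<^sup>2
        \<le> (g x y - w x y)\<^sup>2 + c\<^sup>2 - 2 * c * ((g x y - w x y) * h x y)" by simp
  qed
  also have "\<dots> = (\<Sum>x\<in>V. \<Sum>y\<in>V. (g x y - w x y)\<^sup>2) + c\<^sup>2 * (real (card V))\<^sup>2
      - 2 * c * (\<Sum>x\<in>V. \<Sum>y\<in>V. (g x y - w x y) * h x y)"
    by (simp add: sum.distrib sum_subtractf sum_distrib_left power2_eq_square)
  also have "\<dots> \<le> (\<Sum>x\<in>V. \<Sum>y\<in>V. (g x y - w x y)\<^sup>2) + c\<^sup>2 * (real (card V))\<^sup>2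
      - 2 * c * (c * (real (card V))\<^sup>2)"
    using corr c by (intro diff_left_mono mult_left_mono) auto
  finally show ?thesis by (simp add: power2_eq_square)
qed

section \<open>Finding a useful direction, and the covering argument\<close>

lemma exists_ge_average:
  assumes "finite V" "V \<noteq> {}" "real (card V) * s \<le> (\<Sum>x\<in>V. f x)"
  shows "\<exists>x\<in>V. s \<le> f x"
proof (rule ccontr)
  assume "\<not> ?thesis"
  then have "(\<Sum>x\<in>V. f x) < (\<Sum>x\<in>V. s)" using assms by (intro sum_strict_mono) auto
  then show False using assms by simp
qed

text \<open>In the case of many triples, \<open>w\<close> carries weight at least \<gamma>^3 \<eta>
  n^3 and \<open>G\<close> at most half of it. The difference splits into three telescoping sums,
  and averaging each over one vertex yields the 6 in \<open>c\<close>.\<close>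

lemma exists_direction:
  fixes G :: "'a rel"
  assumes V: "finite V" "V \<noteq> {}" and G: "G \<subseteq> V \<times> V" "\<And>x. (x, x) \<notin> G"
    and w: "\<And>x y. 0 \<le> w x y \<and> w x y \<le> 1"
    and \<gamma>: "0 < \<gamma>" "\<gamma> \<le> 1" and \<eta>: "0 < \<eta>" "\<eta> \<le> 1" and c: "c = \<gamma> ^ 3 * \<eta> / 6"
    and few: "real (card (transitive_triples G)) \<le> \<gamma> ^ 3 * \<eta> / 2 * real (card V) ^ 3"
    and bad: "2 * \<gamma> * (real (card V))\<^sup>2 < real (card (G - heavy_pairs V \<gamma> w))
      \<or> \<eta> * real (card V) ^ 3 < real (card (transitive_triples (heavy_pairs V \<gamma> w)))"
  shows "\<exists>h\<in>directions V \<gamma> w.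
     c * (real (card V))\<^sup>2 \<le> (\<Sum>x\<in>V. \<Sum>y\<in>V. (of_bool ((x, y) \<in> G) - w x y) * h x y)"
proof -
  define n where "n = real (card V)"
  define g :: "'a \<Rightarrow> 'a \<Rightarrow> real" where "g x y = of_bool ((x, y) \<in> G)" for x y
  let ?D = "heavy_pairs V \<gamma> w"
  have "\<gamma> ^ 3 * \<eta> \<le> \<gamma> * 1" using \<gamma> \<eta> by (intro mult_mono) (auto simp: power_le_one power3_eq_cube mult_le_one)
  then have c\<gamma>: "c \<le> \<gamma>" using c \<gamma> by simp
  have "\<exists>h\<in>directions V \<gamma> w. c * n\<^sup>2 \<le> (\<Sum>x\<in>V. \<Sum>y\<in>V. (g x y - w x y) * h x y)"
    using bad unfolding n_def[symmetric]
  proof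
    assume big: "2 * \<gamma> * n\<^sup>2 < real (card (G - ?D))"
    let ?h = "\<lambda>x y. of_bool (w x y \<le> \<gamma>) :: real"
    have "G - ?D = {p \<in> V \<times> V. p \<in> G \<and> w (fst p) (snd p) \<le> \<gamma>}"
      using G by (auto simp: heavy_pairs_def)
    then have "real (card (G - ?D)) = (\<Sum>p\<in>V \<times> V. of_bool (p \<in> G \<and> w (fst p) (snd p) \<le> \<gamma>))"
      using V by (simp only: real_card_filter finite_cartesian_product)
    also have "\<dots> = (\<Sum>x\<in>V. \<Sum>y\<in>V. g x y * ?h x y)"
      by (simp only: sum.cartesian_product split_def g_def prod.collapse of_bool_conj)
    finally have eq: "real (card (G - ?D)) = (\<Sum>x\<in>V. \<Sum>y\<in>V. g x y * ?h x y)" .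
    \<comment> \<open>Where \<open>w\<close> is at most \<gamma>, replacing \<open>w\<close> by
      \<gamma> loses at most \<gamma>, also off \<open>G\<close>. Of the 2 \<gamma> n^2 uncovered
      arcs, \<gamma> n^2 remain, and c <= \<gamma>.\<close>
    have "(\<Sum>x\<in>V. \<Sum>y\<in>V. g x y * ?h x y - \<gamma>) \<le> (\<Sum>x\<in>V. \<Sum>y\<in>V. (g x y - w x y) * ?h x y)"
      using \<gamma> by (intro sum_mono) (auto simp: algebra_simps)
    then have "real (card (G - ?D)) - n * (n * \<gamma>) \<le> (\<Sum>x\<in>V. \<Sum>y\<in>V. (g x y - w x y) * ?h x y)"
      by (simp add: sum_subtractf eq n_def)
    moreover have "c * n\<^sup>2 \<le> \<gamma> * n\<^sup>2" using c\<gamma> by (intro mult_right_mono) auto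
    ultimately have "c * n\<^sup>2 \<le> (\<Sum>x\<in>V. \<Sum>y\<in>V. (g x y - w x y) * ?h x y)"
      using big by (simp add: power2_eq_square algebra_simps)
    then show ?thesis by (intro bexI[of _ ?h]) (simp_all add: directions_def)
  next
    assume many: "\<eta> * n ^ 3 < real (card (transitive_triples ?D))"
    define d where "d x y = w x y - g x y" for x y
    have sub: "?D \<subseteq> V \<times> V" by (auto simp: heavy_pairs_def)
    have "\<gamma> ^ 3 * (\<eta> * n ^ 3) \<le> \<gamma> ^ 3 * real (card (transitive_triples ?D))"
      using many \<gamma> by (intro mult_left_mono) auto
    also have "\<dots> = (\<Sum>x\<in>V. \<Sum>y\<in>V. \<Sum>z\<in>V. \<gamma> ^ 3 * of_bool ((x, y, z) \<in> transitive_triples ?D))"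
      unfolding card_transitive_triples[OF V(1) sub] sum_distrib_left ..
    also have "\<dots> \<le> (\<Sum>x\<in>V. \<Sum>y\<in>V. \<Sum>z\<in>V. w x y * w y z * w x z)"
    proof (intro sum_mono)
      fix x y z
      show "\<gamma> ^ 3 * of_bool ((x, y, z) \<in> transitive_triples ?D) \<le> w x y * w y z * w x z"
      proof (cases "(x, y, z) \<in> transitive_triples ?D")
        case True
        then have "\<gamma> * \<gamma> * \<gamma> \<le> w x y * w y z * w x z"
          using \<gamma> w by (intro mult_mono) (auto simp: heavy_pairs_def)
        then show ?thesis using True by (simp add: power3_eq_cube)
      next
        case False
        then show ?thesis using w by (simp only: of_bool_eq mult_zero_right) simp
      qed
    qed
    finally have W: "\<gamma> ^ 3 * \<eta> * n ^ 3 \<le> (\<Sum>x\<in>V. \<Sum>y\<in>V. \<Sum>z\<in>V. w x y * w y z * w x z)"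
      by (simp add: mult.assoc)
    have "(\<Sum>x\<in>V. \<Sum>y\<in>V. \<Sum>z\<in>V. g x y * g y z * g x z) = real (card (transitive_triples G))"
      unfolding card_transitive_triples[OF V(1) G(1)] g_def transitive_triples_iff of_bool_conj
      by (simp only: mult.assoc)
    then have Gs: "(\<Sum>x\<in>V. \<Sum>y\<in>V. \<Sum>z\<in>V. g x y * g y z * g x z) \<le> \<gamma> ^ 3 * \<eta> / 2 * n ^ 3"
      using few by (simp add: n_def)
    \<comment> \<open>The factors are exchanged one at a time, so each summand reads
      \<open>G\<close> outside \<open>d\<close> only through arcs at a single vertex. Neighbourhoods
      of that vertex therefore describe the direction with O(n) bits.\<close>
    have "(\<Sum>x\<in>V. \<Sum>y\<in>V. \<Sum>z\<in>V. w x y * w y z * w x z) - (\<Sum>x\<in>V. \<Sum>y\<in>V. \<Sum>z\<in>V. g x y * g y z * g x z)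
        = (\<Sum>x\<in>V. \<Sum>y\<in>V. \<Sum>z\<in>V. d x y * (w y z * w x z) + d y z * (g x y * w x z) + d x z * (g x y * g y z))"
      unfolding sum_subtractf[symmetric] d_def by (intro sum.cong refl) (simp add: algebra_simps)
    also have "\<dots> = (\<Sum>x\<in>V. \<Sum>y\<in>V. \<Sum>z\<in>V. d x y * (w y z * w x z))
        + (\<Sum>x\<in>V. \<Sum>y\<in>V. \<Sum>z\<in>V. d y z * (g x y * w x z))
        + (\<Sum>x\<in>V. \<Sum>y\<in>V. \<Sum>z\<in>V. d x z * (g x y * g y z))"
      by (simp only: sum.distrib)
    also have "(\<Sum>x\<in>V. \<Sum>y\<in>V. \<Sum>z\<in>V. d x y * (w y z * w x z))
        = (\<Sum>z\<in>V. \<Sum>x\<in>V. \<Sum>y\<in>V. d x y * (w y z * w x z))"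
      by (subst (2) sum.swap) (intro sum.cong refl sum.swap)
    also have "(\<Sum>x\<in>V. \<Sum>y\<in>V. \<Sum>z\<in>V. d x z * (g x y * g y z))
        = (\<Sum>y\<in>V. \<Sum>x\<in>V. \<Sum>z\<in>V. d x z * (g x y * g y z))"
      by (rule sum.swap)
    finally consider
        "n * (c * n\<^sup>2) \<le> (\<Sum>z\<in>V. \<Sum>x\<in>V. \<Sum>y\<in>V. d x y * (w y z * w x z))"
      | "n * (c * n\<^sup>2) \<le> (\<Sum>x\<in>V. \<Sum>y\<in>V. \<Sum>z\<in>V. d y z * (g x y * w x z))"
      | "n * (c * n\<^sup>2) \<le> (\<Sum>y\<in>V. \<Sum>x\<in>V. \<Sum>z\<in>V. d x z * (g x y * g y z))"
      using W Gs unfolding c by (simp add: power2_eq_square power3_eq_cube) argo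
    then show ?thesis
    proof cases
      case 1
      then obtain z where "z \<in> V" "c * n\<^sup>2 \<le> (\<Sum>x\<in>V. \<Sum>y\<in>V. d x y * (w y z * w x z))"
        using exists_ge_average[OF V] unfolding n_def by blast
      then show ?thesis
        by (intro bexI[of _ "\<lambda>x y. - (w y z * w x z)"])
          (auto simp: directions_def d_def algebra_simps)
    next
      case 2
      then obtain u where "u \<in> V" "c * n\<^sup>2 \<le> (\<Sum>y\<in>V. \<Sum>z\<in>V. d y z * (g u y * w u z))"
        using exists_ge_average[OF V] unfolding n_def by blast
      moreover have "(\<lambda>y z. - (g u y * w u z)) \<in> directions V \<gamma> w"
      proof -
        have "(\<lambda>y z. - (g u y * w u z)) = (\<lambda>(u, A) y z. - (of_bool (y \<in> A) * w u z)) (u, {y. (u, y) \<in> G})"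
          by (simp add: g_def)
        moreover have "(u, {y. (u, y) \<in> G}) \<in> V \<times> Pow V" using G \<open>u \<in> V\<close> by auto
        ultimately show ?thesis unfolding directions_def by blast
      qed
      ultimately show ?thesis
        by (intro bexI[of _ "\<lambda>y z. - (g u y * w u z)"]) (simp_all add: d_def algebra_simps)
    next
      case 3
      then obtain y where "y \<in> V" "c * n\<^sup>2 \<le> (\<Sum>x\<in>V. \<Sum>z\<in>V. d x z * (g x y * g y z))"
        using exists_ge_average[OF V] unfolding n_def by blast
      moreover have "(\<lambda>x z. - (g x y * g y z)) \<in> directions V \<gamma> w"
      proof -
        have "(\<lambda>x z. - (g x y * g y z))
            = (\<lambda>(A, B) x z. - (of_bool (x \<in> A) * of_bool (z \<in> B))) ({x. (x, y) \<in> G}, {z. (y, z) \<in> G})"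
          by (simp add: g_def)
        moreover have "({x. (x, y) \<in> G}, {z. (y, z) \<in> G}) \<in> Pow V \<times> Pow V" using G by auto
        ultimately show ?thesis unfolding directions_def by blast
      qed
      ultimately show ?thesis
        by (intro bexI[of _ "\<lambda>x z. - (g x y * g y z)"]) (simp_all add: d_def algebra_simps)
    qed
  qed
  then show ?thesis by (simp add: n_def g_def)
qed

text \<open>A weighting whose heavy pairs miss too much of \<open>G\<close> or have too many triples
  can be corrected towards \<open>G\<close>; boundedly many corrections must reach one that is
  neither. \<open>K\<close> does not depend on \<open>V\<close>, so the exponent is linear in
  \<open>card V\<close>.\<close>

theorem transitive_triangle_containers:
  fixes \<gamma> \<eta> :: real
  assumes \<gamma>: "0 < \<gamma>" "\<gamma> \<le> 1" and \<eta>: "0 < \<eta>" "\<eta> \<le> 1"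
  shows "\<exists>\<eta>'>0. \<exists>K. \<forall>V :: 'a set. finite V \<longrightarrow> V \<noteq> {} \<longrightarrow>
    (\<exists>\<C>. finite \<C> \<and> card \<C> \<le> 2 ^ ((2 * card V + 3) * K)
      \<and> (\<forall>D\<in>\<C>. D \<subseteq> V \<times> V \<and> (\<forall>x. (x, x) \<notin> D)
            \<and> real (card (transitive_triples D)) \<le> \<eta> * real (card V) ^ 3)
      \<and> (\<forall>G. G \<subseteq> V \<times> V \<longrightarrow> (\<forall>x. (x, x) \<notin> G)
            \<longrightarrow> real (card (transitive_triples G)) \<le> \<eta>' * real (card V) ^ 3
            \<longrightarrow> (\<exists>D\<in>\<C>. real (card (G - D)) \<le> 2 * \<gamma> * (real (card V))\<^sup>2)))"
proof -
  define c where "c = \<gamma> ^ 3 * \<eta> / 6"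
  have c: "0 < c" using assms by (simp add: c_def)
  \<comment> \<open>More corrections than 1/c^2 are impossible, since each lowers a squared distance
    of at most n^2 by c^2 n^2.\<close>
  obtain K :: nat where K: "1 < real K * c\<^sup>2"
    using reals_Archimedean3[of "c\<^sup>2"] c by auto
  have main: "\<exists>\<C>. finite \<C> \<and> card \<C> \<le> 2 ^ ((2 * card V + 3) * K)
      \<and> (\<forall>D\<in>\<C>. D \<subseteq> V \<times> V \<and> (\<forall>x. (x, x) \<notin> D)
            \<and> real (card (transitive_triples D)) \<le> \<eta> * real (card V) ^ 3)
      \<and> (\<forall>G. G \<subseteq> V \<times> V \<longrightarrow> (\<forall>x. (x, x) \<notin> G)
            \<longrightarrow> real (card (transitive_triples G)) \<le> \<gamma> ^ 3 * \<eta> / 2 * real (card V) ^ 3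
            \<longrightarrow> (\<exists>D\<in>\<C>. real (card (G - D)) \<le> 2 * \<gamma> * (real (card V))\<^sup>2))"
    if V: "finite V" "V \<noteq> {}" for V :: "'a set"
  proof -
    define n where "n = real (card V)"
    have n: "0 < n" using V by (simp add: n_def card_gt_0_iff)
    let ?W = "weightings V \<gamma> c"
    define fewD where "fewD w \<longleftrightarrow> real (card (transitive_triples (heavy_pairs V \<gamma> w))) \<le> \<eta> * n ^ 3" for w
    define \<C> where "\<C> = heavy_pairs V \<gamma> ` {w \<in> ?W K. fewD w}"
    have fin: "finite (?W K)" "card (?W K) \<le> 2 ^ ((2 * card V + 3) * K)"
      using finite_card_weightings[OF V(1)] by blast+
    have "card \<C> \<le> card {w \<in> ?W K. fewD w}"
      unfolding \<C>_def using fin by (intro card_image_le) simp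
    also have "\<dots> \<le> card (?W K)" using fin by (intro card_mono) auto
    finally have card\<C>: "card \<C> \<le> 2 ^ ((2 * card V + 3) * K)" using fin by linarith
    have cover: "\<exists>D\<in>\<C>. real (card (G - D)) \<le> 2 * \<gamma> * n\<^sup>2"
      if G: "G \<subseteq> V \<times> V" "\<And>x. (x, x) \<notin> G"
        and few: "real (card (transitive_triples G)) \<le> \<gamma> ^ 3 * \<eta> / 2 * n ^ 3" for G
    proof (rule ccontr)
      assume no: "\<not> ?thesis"
      have mono: "?W k \<subseteq> ?W K" if "k \<le> K" for k
        using that by (induction rule: inc_induct) auto
      \<comment> \<open>If no container covers \<open>G\<close>, every weighting reached is either
        rejected for its triples or fails to cover \<open>G\<close>, so it can be corrected
        again.\<close>
      have "\<exists>w\<in>?W k. (\<Sum>x\<in>V. \<Sum>y\<in>V. (of_bool ((x, y) \<in> G) - w x y)\<^sup>2) \<le> (1 - real k * c\<^sup>2) * n\<^sup>2"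
        if "k \<le> K" for k
        using that
      proof (induction k)
        case 0
        have "(\<Sum>x\<in>V. \<Sum>y\<in>V. (of_bool ((x, y) \<in> G) - 0 :: real)\<^sup>2) \<le> (\<Sum>x\<in>V. \<Sum>y\<in>V. 1)"
          by (intro sum_mono) auto
        then show ?case by (simp add: n_def power2_eq_square)
      next
        case (Suc k)
        then obtain w where w: "w \<in> ?W k"
          and E: "(\<Sum>x\<in>V. \<Sum>y\<in>V. (of_bool ((x, y) \<in> G) - w x y)\<^sup>2) \<le> (1 - real k * c\<^sup>2) * n\<^sup>2" by auto
        have "w \<in> ?W K" using mono[of k] w Suc.prems by auto
        then have bad: "2 * \<gamma> * n\<^sup>2 < real (card (G - heavy_pairs V \<gamma> w))
            \<or> \<eta> * n ^ 3 < real (card (transitive_triples (heavy_pairs V \<gamma> w)))"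
          using no unfolding \<C>_def fewD_def by (auto simp: not_le)
        have range: "0 \<le> w x y \<and> w x y \<le> 1" for x y using weightings_range[OF w] .
        obtain h where h: "h \<in> directions V \<gamma> w"
          and corr: "c * n\<^sup>2 \<le> (\<Sum>x\<in>V. \<Sum>y\<in>V. (of_bool ((x, y) \<in> G) - w x y) * h x y)"
          using exists_direction[OF V G range \<gamma> \<eta> c_def, folded n_def, OF few bad] by blast
        have "(\<Sum>x\<in>V. \<Sum>y\<in>V. (of_bool ((x, y) \<in> G) - clip (w x y + c * h x y))\<^sup>2)
            \<le> (\<Sum>x\<in>V. \<Sum>y\<in>V. (of_bool ((x, y) \<in> G) - w x y)\<^sup>2) - c\<^sup>2 * n\<^sup>2"
          unfolding n_def
          by (rule energy_decrement) (use V c corr directions_abs_le[OF range h] in \<open>auto simp: n_def\<close>)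
        also have "\<dots> \<le> (1 - real (Suc k) * c\<^sup>2) * n\<^sup>2" using E by (simp add: algebra_simps)
        finally show ?case
          using w h by (intro bexI[of _ "\<lambda>x y. clip (w x y + c * h x y)"]) auto
      qed
      then obtain w where "(\<Sum>x\<in>V. \<Sum>y\<in>V. (of_bool ((x, y) \<in> G) - w x y)\<^sup>2) \<le> (1 - real K * c\<^sup>2) * n\<^sup>2"
        by blast
      moreover have "0 \<le> (\<Sum>x\<in>V. \<Sum>y\<in>V. (of_bool ((x, y) \<in> G) - w x y :: real)\<^sup>2)"
        by (intro sum_nonneg) simp
      moreover have "(1 - real K * c\<^sup>2) * n\<^sup>2 < 0" using K n by (intro mult_neg_pos) auto
      ultimately show False by linarith
    qed
    show ?thesis
      using fin card\<C> cover unfolding n_def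
      by (intro exI[of _ \<C>]) (auto simp: \<C>_def fewD_def n_def heavy_pairs_def)
  qed
  have "0 < \<gamma> ^ 3 * \<eta> / 2" using assms by simp
  then show ?thesis using main by blast
qed

section \<open>Blow-ups\<close>

text \<open>Pigeonhole in the style of Kovari, Sos and Turan. A sample \<open>I\<close> of constant
  size \<open>m\<close> from the elements of \<open>V\<close> of high degree has at most 2^m
  subsets, so a positive proportion of \<open>U\<close> shares one \<open>t\<close>-subset. The
  constants are independent of \<open>U\<close> and \<open>V\<close>, which permits
  iteration.\<close>

lemma dense_relation_common_fibre:
  fixes \<delta> :: real
  assumes "0 < \<delta>"
  shows "\<exists>N. \<exists>\<delta>'>(0::real). \<forall>(U :: 'a set) (V :: 'b set) R. finite U \<longrightarrow> U \<noteq> {} \<longrightarrow> finite V \<longrightarrow> N \<le> card V \<longrightarrow> R \<subseteq> U \<times> V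
    \<longrightarrow> \<delta> * card U * card V \<le> card R
    \<longrightarrow> (\<exists>Z\<subseteq>V. card Z = t \<and> \<delta>' * card U \<le> card {u \<in> U. \<forall>z\<in>Z. (u, z) \<in> R})"
proof -
  \<comment> \<open>Large enough that losing \<open>t\<close> incidences per element of
    \<open>U\<close> costs at most half of the \<delta> m/2 available on average.\<close>
  define m where "m = nat \<lceil>4 * real t / \<delta>\<rceil> + 1"
  have m: "4 * real t \<le> \<delta> * real m" "0 < m"
  proof -
    have "4 * real t / \<delta> \<le> real m" unfolding m_def by linarith
    then show "4 * real t \<le> \<delta> * real m" using assms by (simp add: field_simps)
  qed (simp add: m_def)
  define N where "N = nat \<lceil>2 * real m / \<delta>\<rceil>"
  have N: "2 * real m \<le> \<delta> * real k" if "N \<le> k" for k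
  proof -
    have "2 * real m / \<delta> \<le> real k" using that unfolding N_def by linarith
    then show ?thesis using assms by (simp add: field_simps)
  qed
  have "\<exists>Z\<subseteq>V. card Z = t \<and> \<delta> / 4 / 2 ^ m * card U \<le> card {u \<in> U. \<forall>z\<in>Z. (u, z) \<in> R}"
    if U: "finite U" "U \<noteq> {}" and V: "finite V" "N \<le> card V" and R: "R \<subseteq> U \<times> V"
      and dense: "\<delta> * card U * card V \<le> card R" for U :: "'a set" and V :: "'b set" and R
  proof -
    define r :: "'a \<Rightarrow> 'b \<Rightarrow> real" where "r u z = of_bool ((u, z) \<in> R)" for u z
    define d where "d z = (\<Sum>u\<in>U. r u z)" for z
    define u where "u = real (card U)"
    have u: "0 < u" using U by (simp add: u_def card_gt_0_iff)
    have r01: "0 \<le> r x z" "r x z \<le> 1" for x z by (auto simp: r_def)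
    have d_le: "d z \<le> u" for z
      unfolding d_def u_def using r01 by (intro order_trans[OF sum_bounded_above[of U _ 1]]) auto
    have "R = {p \<in> U \<times> V. p \<in> R}" using R by auto
    then have "real (card R) = real (card {p \<in> U \<times> V. p \<in> R})" by (rule arg_cong)
    also have "\<dots> = (\<Sum>p\<in>U \<times> V. of_bool (p \<in> R))"
      using U V by (intro real_card_filter) simp
    also have "\<dots> = (\<Sum>x\<in>U. \<Sum>z\<in>V. r x z)"
      by (simp only: sum.cartesian_product split_def r_def prod.collapse)
    also have "\<dots> = (\<Sum>z\<in>V. d z)" unfolding d_def by (rule sum.swap)
    finally have cR: "real (card R) = (\<Sum>z\<in>V. d z)" .
    define H where "H = {z \<in> V. \<delta> / 2 * u \<le> d z}"
    have "(\<Sum>z\<in>V. d z) \<le> (\<Sum>z\<in>V. of_bool (z \<in> H) * u + \<delta> / 2 * u)"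
      using d_le assms u by (intro sum_mono) (auto simp: H_def add_increasing2)
    also have "\<dots> = (\<Sum>z\<in>V. of_bool (z \<in> H)) * u + real (card V) * (\<delta> / 2 * u)"
      by (simp only: sum.distrib sum_distrib_right sum_constant)
    also have "(\<Sum>z\<in>V. of_bool (z \<in> H)) = real (card {z \<in> V. z \<in> H})"
      by (rule real_card_filter[symmetric, OF V(1)])
    also have "{z \<in> V. z \<in> H} = H" by (auto simp: H_def)
    finally have "\<delta> * u * real (card V) \<le> real (card H) * u + real (card V) * (\<delta> / 2 * u)"
      using dense cR by (simp add: u_def)
    then have "(\<delta> / 2 * real (card V)) * u \<le> real (card H) * u" by (simp add: algebra_simps)
    then have "real m \<le> real (card H)" using u N[OF V(2)] by simp
    then obtain I where I: "I \<subseteq> H" "card I = m" "finite I"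
      using obtain_subset_with_card_n[of m H] by auto
    define good where "good = {x \<in> U. t \<le> card {z \<in> I. (x, z) \<in> R}}"
    \<comment> \<open>Incidences between \<open>U\<close> and \<open>I\<close> counted twice: an
      element contributes at most \<open>m\<close> if it is in \<open>good\<close>, and at most
      \<open>t\<close> otherwise.\<close>
    have "real m * (\<delta> / 2 * u) \<le> (\<Sum>z\<in>I. d z)"
      using I by (intro order_trans[OF _ sum_bounded_below[of I "\<delta> / 2 * u"]]) (auto simp: H_def)
    also have "\<dots> = (\<Sum>x\<in>U. \<Sum>z\<in>I. r x z)" unfolding d_def by (rule sum.swap)
    also have "\<dots> \<le> (\<Sum>x\<in>U. real m * of_bool (x \<in> good) + real t)"
    proof (intro sum_mono)
      fix x assume x: "x \<in> U"
      have eq: "(\<Sum>z\<in>I. r x z) = real (card {z \<in> I. (x, z) \<in> R})"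
        unfolding r_def by (rule real_card_filter[symmetric, OF I(3)])
      have "card {z \<in> I. (x, z) \<in> R} \<le> m" unfolding I(2)[symmetric] using I by (intro card_mono) auto
      then show "(\<Sum>z\<in>I. r x z) \<le> real m * of_bool (x \<in> good) + real t"
        using x unfolding eq by (auto simp: good_def)
    qed
    also have "\<dots> = real m * (\<Sum>x\<in>U. of_bool (x \<in> good)) + u * real t"
      by (simp only: sum.distrib sum_distrib_left sum_constant u_def)
    also have "(\<Sum>x\<in>U. of_bool (x \<in> good)) = real (card {x \<in> U. x \<in> good})"
      by (rule real_card_filter[symmetric, OF U(1)])
    also have "{x \<in> U. x \<in> good} = good" by (auto simp: good_def)
    also have "u * real t \<le> u * (\<delta> * real m / 4)" using m u by (intro mult_left_mono) auto
    finally have "real m * (\<delta> / 4 * u) \<le> real m * real (card good)" by (simp add: algebra_simps)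
    then have good: "\<delta> / 4 * u \<le> real (card good)" using m by simp
    define \<Z> where "\<Z> = {Z \<in> Pow I. card Z = t}"
    define S where "S Z = {x \<in> U. \<forall>z\<in>Z. (x, z) \<in> R}" for Z
    have fin\<Z>: "finite \<Z>" using I by (simp add: \<Z>_def)
    have "good \<subseteq> (\<Union>Z\<in>\<Z>. S Z)"
    proof
      fix x assume x: "x \<in> good"
      then obtain Z where "Z \<subseteq> {z \<in> I. (x, z) \<in> R}" "card Z = t"
        using obtain_subset_with_card_n[of t "{z \<in> I. (x, z) \<in> R}"] by (auto simp: good_def)
      then have "Z \<in> \<Z>" "x \<in> S Z" using x by (auto simp: \<Z>_def S_def good_def)
      then show "x \<in> (\<Union>Z\<in>\<Z>. S Z)" by blast
    qed
    then have "card good \<le> card (\<Union>Z\<in>\<Z>. S Z)"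
      using fin\<Z> U by (intro card_mono) (auto simp: S_def)
    also have "\<dots> \<le> (\<Sum>Z\<in>\<Z>. card (S Z))" by (rule card_UN_le[OF fin\<Z>])
    finally have gs: "real (card good) \<le> (\<Sum>Z\<in>\<Z>. real (card (S Z)))"
      by (simp only: of_nat_sum[symmetric] of_nat_le_iff)
    have "\<exists>Z\<in>\<Z>. \<delta> / 4 / 2 ^ m * u \<le> real (card (S Z))"
    proof (rule ccontr)
      assume no: "\<not> ?thesis"
      have "0 < \<delta> / 4 * u" using assms u by simp
      then have "\<Z> \<noteq> {}" using gs good by auto
      then have "(\<Sum>Z\<in>\<Z>. real (card (S Z))) < (\<Sum>Z\<in>\<Z>. \<delta> / 4 / 2 ^ m * u)"
        using fin\<Z> no by (intro sum_strict_mono) auto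
      also have "\<dots> = real (card \<Z>) * (\<delta> / 4 / 2 ^ m * u)" by simp
      also have "\<dots> \<le> 2 ^ m * (\<delta> / 4 / 2 ^ m * u)"
      proof (intro mult_right_mono)
        have "card \<Z> \<le> card (Pow I)" unfolding \<Z>_def using I by (intro card_mono) auto
        then show "real (card \<Z>) \<le> 2 ^ m" using I by (simp add: card_Pow)
      qed (use assms u in auto)
      finally show False using gs good by simp
    qed
    then obtain Z where "Z \<in> \<Z>" "\<delta> / 4 / 2 ^ m * u \<le> real (card (S Z))" by blast
    moreover have "I \<subseteq> V" using I by (auto simp: H_def)
    ultimately show ?thesis
      unfolding S_def u_def \<Z>_def by (intro exI[of _ Z]) auto
  qed
  moreover have "0 < \<delta> / 4 / 2 ^ m" using assms by simp
  ultimately show ?thesis by blast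
qed

text \<open>The common-fibre lemma is used twice: on pairs against third vertices, which fixes
  \<open>Z\<close> and leaves densely many pairs \<open>P\<close>, and then on \<open>P\<close>
  itself, which fixes \<open>Y\<close>. Any \<open>t\<close> of the remaining first vertices form
  \<open>X\<close>.\<close>

lemma dense_contains_blow_up:
  fixes \<eta> :: real
  assumes "0 < \<eta>" "0 < t"
  shows "\<exists>N. \<forall>(V :: 'a set) D. finite V \<longrightarrow> N \<le> card V \<longrightarrow> D \<subseteq> V \<times> V
    \<longrightarrow> \<eta> * real (card V) ^ 3 \<le> real (card (transitive_triples D))
    \<longrightarrow> (\<exists>X Y Z. X \<subseteq> V \<and> Y \<subseteq> V \<and> Z \<subseteq> V \<and> card X = t \<and> card Y = t \<and> card Z = t
          \<and> X \<times> Y \<subseteq> D \<and> Y \<times> Z \<subseteq> D \<and> X \<times> Z \<subseteq> D)"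
proof -
  obtain N1 and \<delta>1 :: real where \<delta>1: "0 < \<delta>1"
    and fibre1: "\<forall>(U :: ('a \<times> 'a) set) (V :: 'a set) R. finite U \<longrightarrow> U \<noteq> {} \<longrightarrow> finite V
      \<longrightarrow> N1 \<le> card V \<longrightarrow> R \<subseteq> U \<times> V \<longrightarrow> \<eta> * card U * card V \<le> card R
      \<longrightarrow> (\<exists>Z\<subseteq>V. card Z = t \<and> \<delta>1 * card U \<le> card {u \<in> U. \<forall>z\<in>Z. (u, z) \<in> R})"
    using dense_relation_common_fibre[OF assms(1), of t] by (elim exE conjE) (rule that)
  obtain N2 and \<delta>2 :: real where \<delta>2: "0 < \<delta>2"
    and fibre2: "\<forall>(U :: 'a set) (V :: 'a set) R. finite U \<longrightarrow> U \<noteq> {} \<longrightarrow> finite V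
      \<longrightarrow> N2 \<le> card V \<longrightarrow> R \<subseteq> U \<times> V \<longrightarrow> \<delta>1 * card U * card V \<le> card R
      \<longrightarrow> (\<exists>Z\<subseteq>V. card Z = t \<and> \<delta>2 * card U \<le> card {u \<in> U. \<forall>z\<in>Z. (u, z) \<in> R})"
    using dense_relation_common_fibre[OF \<delta>1, of t] by (elim exE conjE) (rule that)
  define N where "N = max (max N1 N2) (max 1 (nat \<lceil>real t / \<delta>2\<rceil>))"
  show ?thesis
  proof (intro exI[of _ N] allI impI)
    fix V :: "'a set" and D
    assume V: "finite V" "N \<le> card V" and D: "D \<subseteq> V \<times> V"
      and many: "\<eta> * real (card V) ^ 3 \<le> real (card (transitive_triples D))"
    have ne: "V \<noteq> {}" using V by (auto simp: N_def)
    define R where "R = {((x, y), z). (x, y, z) \<in> transitive_triples D}"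
    have "bij_betw (\<lambda>(x, y, z). ((x, y), z)) (transitive_triples D) R"
      by (rule bij_betwI[where g = "\<lambda>((x, y), z). (x, y, z)"]) (auto simp: R_def)
    then have "card R = card (transitive_triples D)" by (simp add: bij_betw_same_card)
    then have "\<eta> * card (V \<times> V) * card V \<le> card R"
      using many by (simp add: card_cartesian_product power3_eq_cube mult.assoc)
    moreover have "R \<subseteq> (V \<times> V) \<times> V" using D by (auto simp: R_def)
    ultimately obtain Z where Z: "Z \<subseteq> V" "card Z = t"
      and P: "\<delta>1 * card (V \<times> V) \<le> card {u \<in> V \<times> V. \<forall>z\<in>Z. (u, z) \<in> R}"
      using fibre1[rule_format, of "V \<times> V" V R] V ne by (auto simp: N_def)
    define P where "P = {u \<in> V \<times> V. \<forall>z\<in>Z. (u, z) \<in> R}"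
    have "P \<subseteq> V \<times> V" "\<delta>1 * card V * card V \<le> card P"
      using P by (auto simp: P_def card_cartesian_product mult.assoc)
    then obtain Y where Y: "Y \<subseteq> V" "card Y = t"
      and X0: "\<delta>2 * card V \<le> card {x \<in> V. \<forall>y\<in>Y. (x, y) \<in> P}"
      using fibre2[rule_format, of V V P] V ne by (auto simp: N_def)
    have "real t / \<delta>2 \<le> real (card V)" using V(2) unfolding N_def by linarith
    then have "real t \<le> \<delta>2 * card V" using \<delta>2 by (simp add: field_simps)
    then have "t \<le> card {x \<in> V. \<forall>y\<in>Y. (x, y) \<in> P}" using X0 by linarith
    then obtain X where X: "X \<subseteq> {x \<in> V. \<forall>y\<in>Y. (x, y) \<in> P}" "card X = t"
      by (rule obtain_subset_with_card_n)
    \<comment> \<open>\<open>R\<close> and \<open>P\<close> record arcs only inside whole triples,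
      so reading off the arcs between two classes needs an element of the third. Here
      \<open>0 < t\<close> is essential.\<close>
    have "X \<noteq> {}" "Y \<noteq> {}" "Z \<noteq> {}" using X Y Z assms by auto
    moreover have "(x, y) \<in> D \<and> (y, z) \<in> D \<and> (x, z) \<in> D" if "x \<in> X" "y \<in> Y" "z \<in> Z" for x y z
      using that X by (force simp: P_def R_def)
    ultimately have "X \<times> Y \<subseteq> D" "Y \<times> Z \<subseteq> D" "X \<times> Z \<subseteq> D" by blast+
    then show "\<exists>X Y Z. X \<subseteq> V \<and> Y \<subseteq> V \<and> Z \<subseteq> V \<and> card X = t \<and> card Y = t \<and> card Z = t
          \<and> X \<times> Y \<subseteq> D \<and> Y \<times> Z \<subseteq> D \<and> X \<times> Z \<subseteq> D"
      using X Y Z by (intro exI[of _ X] exI[of _ Y] exI[of _ Z]) auto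
  qed
qed

section \<open>Blow-ups as sub-digraphs up to isomorphism, and deletion to a bipartite
  digraph\<close>

lemma blow_up_T3_simps:
  "pverts (blow_up T3 t) = {0, 1, 2} \<times> {..<t}"
  "((u, i), (v, j)) \<in> parcs (blow_up T3 t) \<longleftrightarrow>
     (u = 0 \<and> v = 1 \<or> u = 1 \<and> v = 2 \<or> u = 0 \<and> v = 2) \<and> i < t \<and> j < t"
  by (auto simp: blow_up_def T3_def)

text \<open>Disjointness of the classes is not assumed: all arcs between two of them are present, so
  a common vertex would carry a loop. Enumerating the classes gives an injective copy.\<close>

lemma not_digraph_free_blow_up_T3:
  fixes G :: "nat pair_pre_digraph"
  assumes G: "pair_digraph G"
    and card: "card X = t" "card Y = t" "card Z = t"
    and sub: "X \<subseteq> pverts G" "Y \<subseteq> pverts G" "Z \<subseteq> pverts G"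
    and arcs: "X \<times> Y \<subseteq> parcs G" "Y \<times> Z \<subseteq> parcs G" "X \<times> Z \<subseteq> parcs G"
  shows "\<not> digraph_free (blow_up T3 t) G"
proof -
  interpret pair_digraph G by (rule G)
  let ?B = "blow_up T3 t"
  have irrefl: "(x, x) \<notin> parcs G" for x using pair_no_loops by fastforce
  have fin: "finite X" "finite Y" "finite Z"
    using sub finite_subset pair_finite_verts by blast+
  obtain fx fy fz where bij: "bij_betw fx {..<t} X" "bij_betw fy {..<t} Y" "bij_betw fz {..<t} Z"
    using ex_bij_betw_nat_finite[OF fin(1)] ex_bij_betw_nat_finite[OF fin(2)] ex_bij_betw_nat_finite[OF fin(3)]
    unfolding card atLeast0LessThan by auto
  define f where "f p = (if fst p = 0 then fx (snd p) else if fst p = 1 then fy (snd p) else fz (snd p))"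
    for p :: "nat \<times> nat"
  have im: "fx i \<in> X" "fy i \<in> Y" "fz i \<in> Z" if "i < t" for i
    using bij that by (auto simp: bij_betw_def)
  have inj: "fx i = fx j \<longleftrightarrow> i = j" "fy i = fy j \<longleftrightarrow> i = j" "fz i = fz j \<longleftrightarrow> i = j"
    if "i < t" "j < t" for i j
    using bij that by (auto simp: bij_betw_def inj_on_def)
  have ne: "x \<noteq> y" if "x \<in> X \<and> y \<in> Y \<or> x \<in> Y \<and> y \<in> Z \<or> x \<in> X \<and> y \<in> Z" for x y
    using that arcs irrefl by auto
  have f_inj: "inj_on f (pverts ?B)"
    using ne[OF disjI1[OF conjI]] ne[OF disjI2[OF disjI1[OF conjI]]] ne[OF disjI2[OF disjI2[OF conjI]]] im inj
    unfolding blow_up_T3_simps inj_on_def f_def by (fastforce dest: sym)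
  have f_arcs: "map_prod f f ` parcs ?B \<subseteq> parcs G"
  proof -
    have "(fx i, fy j) \<in> parcs G" "(fy i, fz j) \<in> parcs G" "(fx i, fz j) \<in> parcs G"
      if "i < t" "j < t" for i j
      using im[OF that(1)] im[OF that(2)] arcs by blast+
    then show ?thesis by (auto simp: blow_up_T3_simps f_def)
  qed
  have B_wf: "parcs ?B \<subseteq> pverts ?B \<times> pverts ?B"
    by (auto simp: blow_up_T3_simps)
  define K where "K = \<lparr>pverts = f ` pverts ?B, parcs = map_prod f f ` parcs ?B\<rparr>"
  define hom where "hom = \<lparr>iso_verts = f, iso_arcs = map_prod f f, iso_head = snd, iso_tail = fst\<rparr>"
  have "wf_digraph (with_proj ?B)" using B_wf by unfold_locales auto
  moreover have "inj_on (map_prod f f) (parcs ?B)"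
    using map_prod_inj_on[OF f_inj f_inj] B_wf by (rule inj_on_subset)
  ultimately have "pre_digraph.digraph_isomorphism (with_proj ?B) hom"
    using f_inj by (auto simp: pre_digraph.digraph_isomorphism_def hom_def)
  moreover have "with_proj K = app_iso hom (with_proj ?B)"
    by (simp add: app_iso_def K_def hom_def with_proj_def)
  ultimately have iso: "digraph_iso (with_proj ?B) (with_proj K)"
    unfolding digraph_iso_def by blast
  have "wf_digraph (with_proj K)" using B_wf by unfold_locales (auto simp: K_def)
  moreover have "pverts K \<subseteq> pverts G"
    using im sub by (auto simp: K_def blow_up_T3_simps f_def)
  ultimately have "subgraph (with_proj K) (with_proj G)"
    using f_arcs wf_digraph_axioms by (auto simp: subgraph_def compatible_def K_def)
  then show ?thesis using iso unfolding digraph_free_def by blast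
qed

text \<open>Already one vertex from each class gives a triangle, which cannot cross a two-part cut
  in all three edges.\<close>

lemma digraph_free_blow_up_T3:
  assumes t: "0 < t" and A: "\<And>u v. (u, v) \<in> parcs G \<Longrightarrow> (u \<in> A) \<noteq> (v \<in> A)"
  shows "digraph_free (blow_up T3 t) G"
  unfolding digraph_free_def
proof
  let ?B = "blow_up T3 t"
  assume "\<exists>K. subgraph (with_proj K) (with_proj G) \<and> digraph_iso (with_proj ?B) (with_proj K)"
  then obtain K f where sub: "subgraph (with_proj K) (with_proj G)"
    and f: "pre_digraph.digraph_isomorphism (with_proj ?B) f" and K: "with_proj K = app_iso f (with_proj ?B)"
    unfolding digraph_iso_def by blast
  \<comment> \<open>An isomorphism carries its own head and tail functions; since the image is a
    pair digraph, they must be the projections.\<close>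
  have proj: "iso_tail f = fst" "iso_head f = snd"
    using arg_cong[OF K, of tail] arg_cong[OF K, of head] by simp_all
  have "parcs K = iso_arcs f ` parcs ?B" using arg_cong[OF K, of arcs] by simp
  moreover have "parcs K \<subseteq> parcs G" using sub by (simp add: subgraph_def)
  ultimately have "(iso_verts f p, iso_verts f q) \<in> parcs G" if "(p, q) \<in> parcs ?B" for p q
    using that f proj unfolding pre_digraph.digraph_isomorphism_def
    by (force simp: prod_eq_iff dest!: bspec[where x = "(p, q)"])
  then have "(iso_verts f (0, 0), iso_verts f (1, 0)) \<in> parcs G"
    "(iso_verts f (1, 0), iso_verts f (2, 0)) \<in> parcs G"
    "(iso_verts f (0, 0), iso_verts f (2, 0)) \<in> parcs G"
    using t by (simp_all add: blow_up_T3_simps)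
  then show False using A by blast
qed

lemma bipartite_after_deletions:
  assumes G: "pair_digraph G" and few: "real (card {(u, v) \<in> parcs G. u \<in> A \<longleftrightarrow> v \<in> A}) \<le> m"
  shows "bipartite_after_changes m G"
proof -
  interpret pair_digraph G by (rule G)
  define G' where "G' = \<lparr>pverts = pverts G, parcs = {(u, v) \<in> parcs G. (u \<in> A) \<noteq> (v \<in> A)}\<rparr>"
  have "pair_digraph G'"
    unfolding G'_def using pair_finite_verts pair_finite_arcs pair_no_loops
    by unfold_locales (auto dest: in_arcsD1 in_arcsD2 intro: finite_subset[OF _ pair_finite_arcs])
  moreover have "bipartite_digraph G'"
    unfolding bipartite_digraph_def bipartite_graph_def
    by (intro exI[of _ "pverts G \<inter> A"] exI[of _ "pverts G - A"])
      (auto simp: mk_symmetric_def G'_def dest: in_arcsD1 in_arcsD2)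
  moreover have "sym_diff (parcs G) (parcs G') = {(u, v) \<in> parcs G. u \<in> A \<longleftrightarrow> v \<in> A}"
    by (auto simp: G'_def)
  ultimately show ?thesis
    unfolding bipartite_after_changes_def using few by (intro exI[of _ G']) (auto simp: G'_def)
qed

section \<open>Counting\<close>

text \<open>The flag lets one argument serve oriented graphs and digraphs; with \<open>False\<close>
  the condition is vacuous.\<close>

definition admissible :: "bool \<Rightarrow> 'a rel \<Rightarrow> bool" where
  "admissible oriented H \<longleftrightarrow> (oriented \<longrightarrow> (\<forall>u v. (u, v) \<in> H \<longrightarrow> (v, u) \<notin> H))"

text \<open>The binary logarithm of the number of states of a pair of vertices that may carry both arcs.\<close>

definition double_weight :: "bool \<Rightarrow> real" where
  "double_weight oriented = (if oriented then log 2 3 else 2)"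

lemma double_weight_bounds: "3 / 2 \<le> double_weight oriented" "double_weight oriented \<le> 2"
proof -
  have "log 2 8 \<le> log 2 (9 :: real)" "log 2 3 \<le> log 2 (4 :: real)" by simp_all
  moreover have "log 2 8 = (3 :: real)" "log 2 9 = 2 * log 2 (3 :: real)" "log 2 4 = (2 :: real)"
    using log_nat_power[of 2 2 3] log_nat_power[of 3 2 2] log_nat_power[of 2 2 2] by simp_all
  ultimately have "3 / 2 \<le> log 2 (3 :: real)" "log 2 (3 :: real) \<le> 2" by linarith+
  then show "3 / 2 \<le> double_weight oriented" "double_weight oriented \<le> 2"
    by (simp_all add: double_weight_def)
qed

text \<open>\<open>p\<close> and \<open>q\<close> tell which of the two arcs is kept. A double edge
  allows 3 or 4 states, a single edge 2, a non-edge 1.\<close>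

lemma card_arc_choices:
  "real (card {(p, q). (p \<longrightarrow> (x, y) \<in> D) \<and> (q \<longrightarrow> (y, x) \<in> D) \<and> \<not> (oriented \<and> p \<and> q)})
     = 2 powr edge_weight (double_weight oriented) D x y" (is "real (card ?S) = _")
proof -
  have "?S = insert (False, False) ((if (x, y) \<in> D then {(True, False)} else {})
     \<union> (if (y, x) \<in> D then {(False, True)} else {})
     \<union> (if (x, y) \<in> D \<and> (y, x) \<in> D \<and> \<not> oriented then {(True, True)} else {}))"
    by (auto split: if_splits)
  then show ?thesis
    unfolding edge_weight_def double_weight_def by (simp split: if_splits)
qed

lemma sum_symmetric_pairs:
  fixes f :: "'a::linorder \<Rightarrow> 'a \<Rightarrow> real"
  assumes "finite V" "\<And>x y. f x y = f y x" "\<And>x. f x x = 0"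
  shows "(\<Sum>x\<in>V. \<Sum>y\<in>V. f x y) = 2 * (\<Sum>(x, y)\<in>{(x, y) \<in> V \<times> V. x < y}. f x y)"
proof -
  let ?g = "\<lambda>x y. if x < y then f x y else 0"
  have "f x y = ?g x y + ?g y x" for x y
    using assms(2)[of x y] assms(3)[of x] by (cases x y rule: linorder_cases) auto
  then have "(\<Sum>x\<in>V. \<Sum>y\<in>V. f x y) = (\<Sum>x\<in>V. \<Sum>y\<in>V. ?g x y + ?g y x)"
    by (intro sum.cong refl)
  also have "\<dots> = (\<Sum>x\<in>V. \<Sum>y\<in>V. ?g x y) + (\<Sum>x\<in>V. \<Sum>y\<in>V. ?g y x)"
    by (simp only: sum.distrib)
  also have "(\<Sum>x\<in>V. \<Sum>y\<in>V. ?g y x) = (\<Sum>x\<in>V. \<Sum>y\<in>V. ?g x y)"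
    by (rule sum.swap)
  also have "(\<Sum>x\<in>V. \<Sum>y\<in>V. ?g x y) = (\<Sum>p\<in>V \<times> V. if fst p < snd p then f (fst p) (snd p) else 0)"
    by (simp only: sum.cartesian_product split_def)
  also have "\<dots> = (\<Sum>p\<in>{p \<in> V \<times> V. fst p < snd p}. f (fst p) (snd p))"
    using assms by (intro sum.inter_filter[symmetric]) simp
  also have "{p \<in> V \<times> V. fst p < snd p} = {(x, y) \<in> V \<times> V. x < y}" by auto
  finally show ?thesis by (simp add: split_def)
qed

text \<open>Admissibility only constrains the two arcs on the same pair, so the choices over pairs
  with \<open>x < y\<close> are independent and their numbers multiply. The division by 2 passes
  from ordered to unordered pairs.\<close>

lemma card_admissible_subsets:
  fixes V :: "'a::linorder set"
  assumes V: "finite V" and D: "D \<subseteq> V \<times> V" "\<And>x. (x, x) \<notin> D"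
  shows "real (card {H. H \<subseteq> D \<and> admissible oriented H})
       = 2 powr ((\<Sum>x\<in>V. \<Sum>y\<in>V. edge_weight (double_weight oriented) D x y) / 2)"
proof -
  let ?w = "edge_weight (double_weight oriented) D"
  define U where "U = {(x, y) \<in> V \<times> V. x < y}"
  define C where "C = (\<lambda>(x, y). {(p, q). (p \<longrightarrow> (x, y) \<in> D) \<and> (q \<longrightarrow> (y, x) \<in> D) \<and> \<not> (oriented \<and> p \<and> q)})"
  have finU: "finite U" by (rule finite_subset[of _ "V \<times> V"]) (use V in \<open>auto simp: U_def\<close>)
  let ?F = "\<lambda>H. restrict (\<lambda>(x, y). ((x, y) \<in> H, (y, x) \<in> H)) U"
  let ?B = "\<lambda>f. {(x, y). (x, y) \<in> U \<and> fst (f (x, y)) \<or> (y, x) \<in> U \<and> snd (f (y, x))}"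
  have "bij_betw ?F {H. H \<subseteq> D \<and> admissible oriented H} (Pi\<^sub>E U C)"
  proof (rule bij_betw_byWitness[where f' = ?B])
    have "?B (?F H) = H" if "H \<subseteq> D" for H
    proof -
      have "(x, y) \<in> U \<or> (y, x) \<in> U" if "(x, y) \<in> H" for x y
      proof -
        have "(x, y) \<in> V \<times> V" "x \<noteq> y" using that \<open>H \<subseteq> D\<close> D by auto
        then show ?thesis by (auto simp: U_def)
      qed
      then show ?thesis by auto
    qed
    then show "\<forall>H\<in>{H. H \<subseteq> D \<and> admissible oriented H}. ?B (?F H) = H" by blast
    have "?F (?B f) = f" if "f \<in> Pi\<^sub>E U C" for f
    proof
      fix p :: "'a \<times> 'a"
      obtain x y where p: "p = (x, y)" by fastforce
      have "(y, x) \<notin> U" if "(x, y) \<in> U" using that by (auto simp: U_def)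
      then show "?F (?B f) p = f p"
        using that PiE_arb[OF that, of p] by (auto simp: p)
    qed
    then show "\<forall>f\<in>Pi\<^sub>E U C. ?F (?B f) = f" by blast
    show "?F ` {H. H \<subseteq> D \<and> admissible oriented H} \<subseteq> Pi\<^sub>E U C"
      by (auto simp: C_def admissible_def PiE_def)
    have "?B f \<subseteq> D \<and> admissible oriented (?B f)" if f: "f \<in> Pi\<^sub>E U C" for f
    proof -
      have "(fst (f (x, y)) \<longrightarrow> (x, y) \<in> D) \<and> (snd (f (x, y)) \<longrightarrow> (y, x) \<in> D)
          \<and> \<not> (oriented \<and> fst (f (x, y)) \<and> snd (f (x, y)))" if "(x, y) \<in> U" for x y
        using PiE_mem[OF f that] by (auto simp: C_def)
      moreover have "(y, x) \<notin> U" if "(x, y) \<in> U" for x y using that by (auto simp: U_def)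
      ultimately show ?thesis by (auto simp: admissible_def)
    qed
    then show "?B ` Pi\<^sub>E U C \<subseteq> {H. H \<subseteq> D \<and> admissible oriented H}" by blast
  qed
  then have "real (card {H. H \<subseteq> D \<and> admissible oriented H}) = real (card (Pi\<^sub>E U C))"
    by (simp only: bij_betw_same_card)
  also have "\<dots> = (\<Prod>p\<in>U. real (card (C p)))"
    by (simp add: card_PiE[OF finU] of_nat_prod)
  also have "\<dots> = (\<Prod>p\<in>U. 2 powr (case p of (x, y) \<Rightarrow> ?w x y))"
    by (intro prod.cong refl) (clarsimp simp only: C_def prod.case card_arc_choices)
  also have "\<dots> = 2 powr (\<Sum>(x, y)\<in>U. ?w x y)"
    by (rule powr_sum[symmetric]) simp
  also have "(\<Sum>(x, y)\<in>U. ?w x y) = (\<Sum>x\<in>V. \<Sum>y\<in>V. ?w x y) / 2"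
    unfolding U_def using D by (subst sum_symmetric_pairs[OF V edge_weight_sym]) (auto simp: edge_weight_def)
  finally show ?thesis .
qed

text \<open>For \<open>0 < x < 1\<close> the number of subsets of size at most \<open>\<kappa> N\<close> is at most
  \<open>x powr (- \<kappa> N) * (1 + x) ^ N\<close>.\<close>

lemma few_small_subsets:
  fixes \<epsilon> :: real
  assumes "0 < \<epsilon>"
  shows "\<exists>\<kappa>>0. \<forall>S :: 'a set. finite S \<longrightarrow>
    real (card {F. F \<subseteq> S \<and> real (card F) \<le> \<kappa> * real (card S)}) \<le> 2 powr (\<epsilon> * real (card S))"
proof -
  \<comment> \<open>Each of the two factors of the bound receives half of the exponent:
    \<open>x\<close> makes 1 + x at most 2^(\<epsilon>/2), and \<open>\<kappa>\<close> below makes x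
    powr (- \<kappa> N) equal to 2^(\<epsilon> N/2).\<close>
  define x where "x = min (1 / 2) (2 powr (\<epsilon> / 2) - 1)"
  have x: "0 < x" "x < 1" "1 + x \<le> 2 powr (\<epsilon> / 2)"
    using assms powr_less_mono[of 0 "\<epsilon> / 2" 2] by (auto simp: x_def)
  define L where "L = - log 2 x"
  have L: "0 < L" "2 powr (- L) = x" using x by (auto simp: L_def)
  define \<kappa> where "\<kappa> = \<epsilon> / (2 * L)"
  have "real (card {F. F \<subseteq> S \<and> real (card F) \<le> \<kappa> * real (card S)}) \<le> 2 powr (\<epsilon> * real (card S))"
    if S: "finite S" for S :: "'a set"
  proof -
    let ?N = "real (card S)"
    let ?M = "{F. F \<subseteq> S \<and> real (card F) \<le> \<kappa> * ?N}"
    have sub: "?M \<subseteq> Pow S" by auto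
    have "2 powr (- (\<epsilon> / 2) * ?N) * real (card ?M) = (\<Sum>F\<in>?M. 2 powr (- (\<epsilon> / 2) * ?N))" by simp
    also have "\<dots> \<le> (\<Sum>F\<in>?M. x ^ card F)"
    proof (intro sum_mono)
      fix F assume "F \<in> ?M"
      then have "L * real (card F) \<le> L * (\<kappa> * ?N)" using L by (intro mult_left_mono) auto
      also have "\<dots> = \<epsilon> / 2 * ?N" using L by (simp add: \<kappa>_def)
      finally have "2 powr (- (\<epsilon> / 2) * ?N) \<le> 2 powr (- L * real (card F))" by simp
      also have "\<dots> = x ^ card F"
        using x by (simp only: powr_powr[symmetric] L(2) powr_realpow)
      finally show "2 powr (- (\<epsilon> / 2) * ?N) \<le> x ^ card F" .
    qed
    also have "\<dots> \<le> (\<Sum>F\<in>Pow S. x ^ card F)"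
      using S x sub by (intro sum_mono2) auto
    also have "\<dots> = (1 + x) ^ card S"
      using prod_add[OF S, of "\<lambda>_. x" "\<lambda>_. 1"] by (simp add: add.commute)
    also have "\<dots> \<le> (2 powr (\<epsilon> / 2)) ^ card S" using x by (intro power_mono) auto
    also have "\<dots> = 2 powr (\<epsilon> / 2 * ?N)"
      by (simp only: powr_powr[symmetric] powr_realpow powr_gt_zero zero_neq_numeral[symmetric] simp_thms)
    finally have "2 powr (\<epsilon> / 2 * ?N) * (2 powr (- (\<epsilon> / 2) * ?N) * real (card ?M))
        \<le> 2 powr (\<epsilon> / 2 * ?N) * 2 powr (\<epsilon> / 2 * ?N)"
      by (intro mult_left_mono) auto
    then show ?thesis by (simp add: mult.assoc[symmetric] powr_add[symmetric])
  qed
  moreover have "0 < \<kappa>" using assms L by (simp add: \<kappa>_def)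
  ultimately show ?thesis by blast
qed

lemma edge_weight_complete_bipartite:
  assumes "finite A" "finite B" "A \<inter> B = {}"
  shows "(\<Sum>x\<in>A \<union> B. \<Sum>y\<in>A \<union> B. edge_weight a (A \<times> B \<union> B \<times> A) x y) = 2 * a * real (card A * card B)"
proof -
  let ?w = "edge_weight a (A \<times> B \<union> B \<times> A)"
  have "(\<Sum>x\<in>A. \<Sum>y\<in>A. ?w x y) = 0" "(\<Sum>x\<in>B. \<Sum>y\<in>B. ?w x y) = 0"
    using assms by (auto simp: edge_weight_def intro!: sum.neutral)
  moreover have "(\<Sum>x\<in>A. \<Sum>y\<in>B. ?w x y) = (\<Sum>x\<in>A. \<Sum>y\<in>B. a)" "(\<Sum>x\<in>B. \<Sum>y\<in>A. ?w x y) = (\<Sum>x\<in>B. \<Sum>y\<in>A. a)"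
    by (intro sum.cong refl; simp add: edge_weight_def)+
  ultimately show ?thesis
    using assms by (simp add: sum.union_disjoint sum.distrib)
qed

section \<open>Free graphs: the bipartite lower bound and the final count\<close>

definition free_graphs :: "bool \<Rightarrow> nat \<Rightarrow> nat \<Rightarrow> nat pair_pre_digraph set" where
  "free_graphs oriented t n = {G. pair_digraph G \<and> pverts G = {1..n} \<and> admissible oriented (parcs G)
     \<and> digraph_free (blow_up T3 t) G}"

lemma finite_free_graphs: "finite (free_graphs oriented t n)"
proof -
  have "G \<in> (\<lambda>H. \<lparr>pverts = {1..n}, parcs = H\<rparr>) ` Pow ({1..n} \<times> {1..n})" if G: "G \<in> free_graphs oriented t n" for G
  proof -
    interpret pair_digraph G using G by (simp add: free_graphs_def)
    have "parcs G \<subseteq> {1..n} \<times> {1..n}"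
      using G in_arcsD1 in_arcsD2 by (auto simp: free_graphs_def)
    moreover have "G = \<lparr>pverts = {1..n}, parcs = parcs G\<rparr>" using G by (simp add: free_graphs_def)
    ultimately show ?thesis by blast
  qed
  then have "free_graphs oriented t n \<subseteq> (\<lambda>H. \<lparr>pverts = {1..n}, parcs = H\<rparr>) ` Pow ({1..n} \<times> {1..n})"
    by (rule subsetI)
  moreover have "finite \<dots>" by (intro finite_imageI) simp
  ultimately show ?thesis by (rule finite_subset)
qed

text \<open>All admissible subsets of the balanced complete bipartite digraph with double edges are
  free. The \<open>- 1\<close> covers odd \<open>n\<close>, where the parts have product (n^2 -
  1)/4.\<close>

lemma card_free_ge:
  assumes "0 < t"
  shows "2 powr (double_weight oriented * ((real n)\<^sup>2 - 1) / 4) \<le> real (card (free_graphs oriented t n))"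
proof -
  define A B where "A = {1..n div 2}" and "B = {n div 2 + 1..n}"
  have AB: "finite A" "finite B" "A \<inter> B = {}" "A \<union> B = {1..n}"
    by (auto simp: A_def B_def)
  let ?D = "A \<times> B \<union> B \<times> A"
  have "(real n)\<^sup>2 - 1 \<le> 4 * real (card A * card B)"
  proof (cases "even n")
    case True
    then obtain k where "n = 2 * k" by blast
    then show ?thesis by (simp add: A_def B_def power2_eq_square)
  next
    case False
    then obtain k where "n = 2 * k + 1" by (elim oddE)
    then show ?thesis by (simp add: A_def B_def power2_eq_square algebra_simps)
  qed
  then have "double_weight oriented * ((real n)\<^sup>2 - 1) \<le> double_weight oriented * (4 * real (card A * card B))"
    using double_weight_bounds[of oriented] by (intro mult_left_mono) auto
  then have "2 powr (double_weight oriented * ((real n)\<^sup>2 - 1) / 4) \<le> 2 powr (2 * double_weight oriented * real (card A * card B) / 2)"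
    by (intro powr_mono) auto
  also have "\<dots> = real (card {H. H \<subseteq> ?D \<and> admissible oriented H})"
    unfolding edge_weight_complete_bipartite[OF AB(1-3), symmetric]
    using AB by (intro card_admissible_subsets[symmetric]) auto
  also have "\<dots> \<le> real (card (free_graphs oriented t n))"
  proof (intro of_nat_mono card_inj_on_le[OF _ _ finite_free_graphs])
    show "inj_on (\<lambda>H. \<lparr>pverts = {1..n}, parcs = H\<rparr>) {H. H \<subseteq> ?D \<and> admissible oriented H}"
      by (auto simp: inj_on_def)
    show "(\<lambda>H. \<lparr>pverts = {1..n}, parcs = H\<rparr>) ` {H. H \<subseteq> ?D \<and> admissible oriented H} \<subseteq> free_graphs oriented t n"
    proof (clarify)
      fix H assume H: "H \<subseteq> ?D" "admissible oriented H"
      let ?G = "\<lparr>pverts = {1..n}, parcs = H\<rparr>"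
      have sub: "H \<subseteq> {1..n} \<times> {1..n}" using H(1) AB(4) by auto
      have cross: "(u \<in> A) \<noteq> (v \<in> A)" if "(u, v) \<in> H" for u v
        using that H(1) AB(3) by auto
      have "pair_digraph ?G"
        using sub cross by unfold_locales (auto intro: finite_subset[OF sub] dest: cross)
      moreover have "digraph_free (blow_up T3 t) ?G"
        using cross by (intro digraph_free_blow_up_T3[OF assms, of _ A]) simp
      ultimately show "?G \<in> free_graphs oriented t n" using H by (simp add: free_graphs_def)
    qed
  qed
  finally show ?thesis .
qed

lemma admissible_subset: "admissible oriented H \<Longrightarrow> H' \<subseteq> H \<Longrightarrow> admissible oriented H'"
  unfolding admissible_def by blast

text \<open>Graphs far from bipartite lie, up to a small set of arcs, in containers whose weight is
  too small. In the exponent this gains \<epsilon>0 n^2/2; the extra arcs cost \<epsilon>0 n^2/8,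
  lower-order terms at most another eighth, and \<epsilon>0 n^2/4 is left.\<close>

lemma almost_all_free_near_bipartite:
  fixes \<alpha> :: real
  assumes t: "0 < t" and \<alpha>: "0 < \<alpha>"
  shows "\<exists>\<epsilon>>0. \<forall>\<^sub>F n in sequentially.
    real (card {G \<in> free_graphs oriented t n. \<not> bipartite_after_changes (\<alpha> * (real n)\<^sup>2) G})
      \<le> real (card (free_graphs oriented t n)) * 2 powr (- \<epsilon> * (real n)\<^sup>2)"
proof -
  define a where "a = double_weight oriented"
  have a: "3 / 2 \<le> a" "a \<le> 2" using double_weight_bounds by (auto simp: a_def)
  have "0 < \<alpha> / 2" using \<alpha> by simp
  from transitive_triangle_stability[OF a this, where ?'a = nat]
  obtain \<epsilon>0 \<eta>0 where \<epsilon>0: "0 < \<epsilon>0" and \<eta>0: "0 < \<eta>0"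
    and stab: "\<forall>(V :: nat set) D. finite V \<longrightarrow> V \<noteq> {} \<longrightarrow> D \<subseteq> V \<times> V \<longrightarrow> (\<forall>x. (x, x) \<notin> D)
     \<longrightarrow> real (card (transitive_triples D)) \<le> \<eta>0 * real (card V) ^ 3
     \<longrightarrow> (a / 2 - \<epsilon>0) * (real (card V))\<^sup>2 \<le> (\<Sum>x\<in>V. \<Sum>y\<in>V. edge_weight a D x y)
     \<longrightarrow> (\<exists>A\<subseteq>V. real (card {(u, v) \<in> D. u \<in> A \<longleftrightarrow> v \<in> A}) \<le> \<alpha> / 2 * (real (card V))\<^sup>2)"
    by (elim exE conjE) (rule that)
  have "0 < \<epsilon>0 / 8" using \<epsilon>0 by simp
  from few_small_subsets[OF this, where ?'a = "nat \<times> nat"] obtain \<kappa> where \<kappa>: "0 < \<kappa>"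
    and small: "\<forall>S :: (nat \<times> nat) set. finite S \<longrightarrow>
      real (card {F. F \<subseteq> S \<and> real (card F) \<le> \<kappa> * real (card S)}) \<le> 2 powr (\<epsilon>0 / 8 * real (card S))"
    by (elim exE conjE) (rule that)
  define \<eta> where "\<eta> = min \<eta>0 1"
  define \<gamma> where "\<gamma> = min 1 (min (\<kappa> / 2) (\<alpha> / 4))"
  have \<eta>: "0 < \<eta>" "\<eta> \<le> 1" "\<eta> \<le> \<eta>0" and \<gamma>: "0 < \<gamma>" "\<gamma> \<le> 1" "2 * \<gamma> \<le> \<kappa>" "2 * \<gamma> \<le> \<alpha> / 2"
    using \<eta>0 \<kappa> \<alpha> by (auto simp: \<eta>_def \<gamma>_def)
  from transitive_triangle_containers[OF \<gamma>(1,2) \<eta>(1,2), where ?'a = nat]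
  obtain \<eta>' K where \<eta>': "0 < \<eta>'" and cont: "\<forall>V :: nat set. finite V \<longrightarrow> V \<noteq> {} \<longrightarrow>
    (\<exists>\<C>. finite \<C> \<and> card \<C> \<le> 2 ^ ((2 * card V + 3) * K)
      \<and> (\<forall>D\<in>\<C>. D \<subseteq> V \<times> V \<and> (\<forall>x. (x, x) \<notin> D)
            \<and> real (card (transitive_triples D)) \<le> \<eta> * real (card V) ^ 3)
      \<and> (\<forall>G. G \<subseteq> V \<times> V \<longrightarrow> (\<forall>x. (x, x) \<notin> G)
            \<longrightarrow> real (card (transitive_triples G)) \<le> \<eta>' * real (card V) ^ 3
            \<longrightarrow> (\<exists>D\<in>\<C>. real (card (G - D)) \<le> 2 * \<gamma> * (real (card V))\<^sup>2)))"
    by (elim exE conjE) (rule that)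
  from dense_contains_blow_up[OF \<eta>' t, where ?'a = nat]
  obtain N where blow: "\<forall>(V :: nat set) D. finite V \<longrightarrow> N \<le> card V \<longrightarrow> D \<subseteq> V \<times> V
    \<longrightarrow> \<eta>' * real (card V) ^ 3 \<le> real (card (transitive_triples D))
    \<longrightarrow> (\<exists>X Y Z. X \<subseteq> V \<and> Y \<subseteq> V \<and> Z \<subseteq> V \<and> card X = t \<and> card Y = t \<and> card Z = t
          \<and> X \<times> Y \<subseteq> D \<and> Y \<times> Z \<subseteq> D \<and> X \<times> Z \<subseteq> D)"
    by (elim exE) (rule that)
  define N' where "N' = max (max N 1) (nat \<lceil>8 * (5 * real K + 1) / \<epsilon>0\<rceil>)"
  have main: "real (card {G \<in> free_graphs oriented t n. \<not> bipartite_after_changes (\<alpha> * (real n)\<^sup>2) G})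
      \<le> real (card (free_graphs oriented t n)) * 2 powr (- (\<epsilon>0 / 4) * (real n)\<^sup>2)"
    if n: "N' \<le> n" for n
  proof -
    let ?V = "{1..n}" and ?w = "edge_weight a"
    let ?far = "{G \<in> free_graphs oriented t n. \<not> bipartite_after_changes (\<alpha> * (real n)\<^sup>2) G}"
    have n1: "1 \<le> n" "N \<le> n" using n by (auto simp: N'_def)
    have V: "finite ?V" "?V \<noteq> {}" "card ?V = n" using n1 by auto
    from cont[rule_format, OF V(1,2), unfolded V(3)]
    obtain \<C> where \<C>: "finite \<C>" "card \<C> \<le> 2 ^ ((2 * n + 3) * K)"
      and \<C>D: "\<forall>D\<in>\<C>. D \<subseteq> ?V \<times> ?V \<and> (\<forall>x. (x, x) \<notin> D)
            \<and> real (card (transitive_triples D)) \<le> \<eta> * real n ^ 3"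
      and cover: "\<forall>G. G \<subseteq> ?V \<times> ?V \<longrightarrow> (\<forall>x. (x, x) \<notin> G)
            \<longrightarrow> real (card (transitive_triples G)) \<le> \<eta>' * real n ^ 3
            \<longrightarrow> (\<exists>D\<in>\<C>. real (card (G - D)) \<le> 2 * \<gamma> * (real n)\<^sup>2)"
      by (elim exE conjE) (rule that)
    define light where "light D \<longleftrightarrow> (\<Sum>x\<in>?V. \<Sum>y\<in>?V. ?w D x y) \<le> (a / 2 - \<epsilon>0) * (real n)\<^sup>2" for D
    define \<H> where "\<H> D = {H. H \<subseteq> D \<and> admissible oriented H}" for D :: "nat rel"
    define \<F> where "\<F> = {F. F \<subseteq> ?V \<times> ?V \<and> real (card F) \<le> \<kappa> * real (card (?V \<times> ?V))}"
    let ?cands = "\<Union>D\<in>{D \<in> \<C>. light D}. (\<lambda>(H, F). H \<union> F) ` (\<H> D \<times> \<F>)"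
    have fin\<F>: "finite \<F>" by (rule finite_subset[of _ "Pow (?V \<times> ?V)"]) (auto simp: \<F>_def)
    have fin\<H>: "finite (\<H> D)" if "D \<in> \<C>" for D
      by (rule finite_subset[of _ "Pow (?V \<times> ?V)"]) (use that \<C>D in \<open>auto simp: \<H>_def\<close>)
    \<comment> \<open>\<open>G\<close> is recovered from its part inside a light container and its
      few arcs outside it.\<close>
    have "parcs G \<in> ?cands" if G: "G \<in> ?far" for G
    proof -
      have pd: "pair_digraph G" and vG: "pverts G = ?V" and adm: "admissible oriented (parcs G)"
        and free: "digraph_free (blow_up T3 t) G" and far: "\<not> bipartite_after_changes (\<alpha> * (real n)\<^sup>2) G"
        using G by (auto simp: free_graphs_def)
      interpret pair_digraph G by (rule pd)
      have sub: "parcs G \<subseteq> ?V \<times> ?V" using in_arcsD1 in_arcsD2 vG by auto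
      have irrefl: "\<forall>x. (x, x) \<notin> parcs G" using pair_no_loops by fastforce
      have "real (card (transitive_triples (parcs G))) \<le> \<eta>' * real n ^ 3"
      proof (rule ccontr)
        assume "\<not> ?thesis"
        then have many: "\<eta>' * real (card ?V) ^ 3 \<le> real (card (transitive_triples (parcs G)))" by simp
        have "N \<le> card ?V" using n1 by simp
        from blow[rule_format, OF V(1) this sub many]
        obtain X Y Z where "X \<subseteq> ?V" "Y \<subseteq> ?V" "Z \<subseteq> ?V" "card X = t" "card Y = t" "card Z = t"
          "X \<times> Y \<subseteq> parcs G" "Y \<times> Z \<subseteq> parcs G" "X \<times> Z \<subseteq> parcs G" by blast
        then show False using not_digraph_free_blow_up_T3[OF pd, of X t Y Z] free vG by simp
      qed
      then obtain D where D: "D \<in> \<C>" and diff: "real (card (parcs G - D)) \<le> 2 * \<gamma> * (real n)\<^sup>2"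
        using cover sub irrefl by blast
      \<comment> \<open>A heavy container has a near bipartition by stability, and \<open>G\<close>
        inherits it up to the arcs outside \<open>D\<close>, so \<open>G\<close> would not be
        far.\<close>
      have "light D"
      proof (rule ccontr)
        assume "\<not> light D"
        then have heavy: "(a / 2 - \<epsilon>0) * (real (card ?V))\<^sup>2 \<le> (\<Sum>x\<in>?V. \<Sum>y\<in>?V. ?w D x y)"
          by (simp add: light_def)
        have DV: "D \<subseteq> ?V \<times> ?V" "\<forall>x. (x, x) \<notin> D" using \<C>D D by auto
        have "real (card (transitive_triples D)) \<le> \<eta> * real n ^ 3" using \<C>D D by auto
        also have "\<dots> \<le> \<eta>0 * real n ^ 3" using \<eta> by (intro mult_right_mono) auto
        finally have "real (card (transitive_triples D)) \<le> \<eta>0 * real (card ?V) ^ 3" by simp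
        from stab[rule_format, OF V(1,2) DV(1) _ this heavy] DV(2)
        obtain A where A: "real (card {(u, v) \<in> D. u \<in> A \<longleftrightarrow> v \<in> A}) \<le> \<alpha> / 2 * (real n)\<^sup>2" by auto
        have "finite D" using DV(1) by (rule finite_subset) simp
        then have finDA: "finite {(u, v) \<in> D. u \<in> A \<longleftrightarrow> v \<in> A}" by (rule finite_subset[rotated]) auto
        have "card {(u, v) \<in> parcs G. u \<in> A \<longleftrightarrow> v \<in> A}
            \<le> card ({(u, v) \<in> D. u \<in> A \<longleftrightarrow> v \<in> A} \<union> (parcs G - D))"
          using finDA pair_finite_arcs by (intro card_mono) auto
        also have "\<dots> \<le> card {(u, v) \<in> D. u \<in> A \<longleftrightarrow> v \<in> A} + card (parcs G - D)"
          by (rule card_Un_le)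
        finally have "real (card {(u, v) \<in> parcs G. u \<in> A \<longleftrightarrow> v \<in> A})
            \<le> real (card {(u, v) \<in> D. u \<in> A \<longleftrightarrow> v \<in> A}) + real (card (parcs G - D))"
          by (simp only: of_nat_add[symmetric] of_nat_le_iff)
        also have "\<dots> \<le> \<alpha> / 2 * (real n)\<^sup>2 + \<alpha> / 2 * (real n)\<^sup>2"
          using A diff \<gamma>(4) by (intro add_mono order_trans[OF diff] mult_right_mono) auto
        also have "\<dots> = \<alpha> * (real n)\<^sup>2" by simp
        finally show False using far bipartite_after_deletions[OF pd] by blast
      qed
      moreover have "parcs G \<inter> D \<in> \<H> D" using adm by (auto simp: \<H>_def intro: admissible_subset)
      moreover have "parcs G - D \<in> \<F>"
      proof -
        have "2 * \<gamma> * (real n)\<^sup>2 \<le> \<kappa> * (real n)\<^sup>2" using \<gamma> by (intro mult_right_mono) auto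
        then show ?thesis using diff sub by (auto simp: \<F>_def card_cartesian_product power2_eq_square)
      qed
      moreover have "parcs G = (\<lambda>(H, F). H \<union> F) (parcs G \<inter> D, parcs G - D)" by auto
      ultimately show ?thesis using D by blast
    qed
    moreover have "inj_on parcs ?far"
      by (rule inj_onI) (auto simp: free_graphs_def intro: pair_pre_digraph.equality)
    moreover have "finite ?cands" using \<C> fin\<H> fin\<F> by auto
    ultimately have "card ?far \<le> card ?cands" by (intro card_inj_on_le[of parcs]) auto
    also have "\<dots> \<le> (\<Sum>D\<in>{D \<in> \<C>. light D}. card ((\<lambda>(H, F). H \<union> F) ` (\<H> D \<times> \<F>)))"
      using \<C> by (intro card_UN_le) simp
    also have "\<dots> \<le> (\<Sum>D\<in>{D \<in> \<C>. light D}. card (\<H> D) * card \<F>)"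
      using fin\<H> fin\<F>
      by (intro sum_mono order_trans[OF card_image_le]) (auto simp: card_cartesian_product)
    finally have "real (card ?far) \<le> (\<Sum>D\<in>{D \<in> \<C>. light D}. real (card (\<H> D)) * real (card \<F>))"
      by (simp only: of_nat_mult[symmetric] of_nat_sum[symmetric] of_nat_le_iff)
    also have "\<dots> \<le> (\<Sum>D\<in>{D \<in> \<C>. light D}. 2 powr ((a / 2 - \<epsilon>0) * (real n)\<^sup>2 / 2) * 2 powr (\<epsilon>0 / 8 * (real n)\<^sup>2))"
    proof (intro sum_mono mult_mono)
      fix D assume D: "D \<in> {D \<in> \<C>. light D}"
      have "real (card (\<H> D)) = 2 powr ((\<Sum>x\<in>?V. \<Sum>y\<in>?V. ?w D x y) / 2)"
        unfolding \<H>_def a_def using D \<C>D by (intro card_admissible_subsets) auto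
      also have "\<dots> \<le> 2 powr ((a / 2 - \<epsilon>0) * (real n)\<^sup>2 / 2)"
        using D by (intro powr_mono) (auto simp: light_def)
      finally show "real (card (\<H> D)) \<le> 2 powr ((a / 2 - \<epsilon>0) * (real n)\<^sup>2 / 2)" .
      show "real (card \<F>) \<le> 2 powr (\<epsilon>0 / 8 * (real n)\<^sup>2)"
        using small[rule_format, of "?V \<times> ?V"] by (simp add: \<F>_def card_cartesian_product power2_eq_square)
    qed auto
    also have "\<dots> = real (card {D \<in> \<C>. light D}) * 2 powr ((a / 2 - \<epsilon>0) * (real n)\<^sup>2 / 2 + \<epsilon>0 / 8 * (real n)\<^sup>2)"
      by (simp add: powr_add)
    also have "\<dots> \<le> 2 powr real ((2 * n + 3) * K) * 2 powr ((a / 2 - \<epsilon>0) * (real n)\<^sup>2 / 2 + \<epsilon>0 / 8 * (real n)\<^sup>2)"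
    proof (intro mult_right_mono)
      have "card {D \<in> \<C>. light D} \<le> card \<C>" using \<C> by (intro card_mono) auto
      then have "card {D \<in> \<C>. light D} \<le> 2 ^ ((2 * n + 3) * K)" using \<C>(2) by (rule order_trans)
      then have "real (card {D \<in> \<C>. light D}) \<le> real (2 ^ ((2 * n + 3) * K))" by (simp only: of_nat_le_iff)
      then show "real (card {D \<in> \<C>. light D}) \<le> 2 powr real ((2 * n + 3) * K)"
        by (subst powr_realpow) simp_all
    qed simp
    also have "\<dots> = 2 powr (real ((2 * n + 3) * K) + ((a / 2 - \<epsilon>0) * (real n)\<^sup>2 / 2 + \<epsilon>0 / 8 * (real n)\<^sup>2))"
      by (rule powr_add[symmetric])
    also have "\<dots> \<le> 2 powr (a * ((real n)\<^sup>2 - 1) / 4 + - (\<epsilon>0 / 4) * (real n)\<^sup>2)"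
    \<comment> \<open>\<open>N'\<close> makes \<epsilon>0 n^2/8 at least (5K + 1) n. This pays 5 K n
      for the number of containers and \<open>n\<close> for the a/4 lost in the lower bound.\<close>
    proof (intro powr_mono)
      have "8 * (5 * real K + 1) / \<epsilon>0 \<le> real n" using n unfolding N'_def by linarith
      then have "8 * (5 * real K + 1) \<le> \<epsilon>0 * real n" using \<epsilon>0 by (simp add: field_simps)
      then have "8 * (5 * real K + 1) * real n \<le> \<epsilon>0 * real n * real n" by (rule mult_right_mono) simp
      moreover have "real ((2 * n + 3) * K) \<le> 5 * real K * real n"
      proof -
        have "(2 * real n + 3) * real K \<le> (5 * real n) * real K"
          using n1 by (intro mult_right_mono) auto
        then show ?thesis by (simp add: mult_ac)
      qed
      moreover have "a / 4 \<le> real n" using a n1 by linarith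
      ultimately show "real ((2 * n + 3) * K) + ((a / 2 - \<epsilon>0) * (real n)\<^sup>2 / 2 + \<epsilon>0 / 8 * (real n)\<^sup>2)
          \<le> a * ((real n)\<^sup>2 - 1) / 4 + - (\<epsilon>0 / 4) * (real n)\<^sup>2"
        by (simp add: power2_eq_square field_simps)
    qed simp
    also have "\<dots> = 2 powr (a * ((real n)\<^sup>2 - 1) / 4) * 2 powr (- (\<epsilon>0 / 4) * (real n)\<^sup>2)"
      by (rule powr_add)
    also have "\<dots> \<le> real (card (free_graphs oriented t n)) * 2 powr (- (\<epsilon>0 / 4) * (real n)\<^sup>2)"
      using card_free_ge[OF t, of oriented n] by (intro mult_right_mono) (auto simp: a_def)
    finally show ?thesis .
  qed
  have "\<forall>\<^sub>F n in sequentially.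
    real (card {G \<in> free_graphs oriented t n. \<not> bipartite_after_changes (\<alpha> * (real n)\<^sup>2) G})
      \<le> real (card (free_graphs oriented t n)) * 2 powr (- (\<epsilon>0 / 4) * (real n)\<^sup>2)"
    using main unfolding eventually_sequentially by blast
  then show ?thesis using \<epsilon>0 by (intro exI[of _ "\<epsilon>0 / 4"]) simp
qed

lemma free_graphs_eq:
  "free_graphs True t n = free_oriented_graphs n (blow_up T3 t)"
  "free_graphs False t n = free_digraphs n (blow_up T3 t)"
  by (auto simp: free_graphs_def free_oriented_graphs_def free_digraphs_def labelled_oriented_graphs_def
      labelled_digraphs_def oriented_graph_def admissible_def)

theorem theorem1p4:
  fixes r t :: nat and \<alpha> :: real
  assumes "r \<ge> 2" and "t \<ge> 1" and "\<alpha> > 0"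
  shows "\<exists>\<epsilon>>0. \<forall>\<^sub>F n in sequentially.
    real (card {G \<in> free_oriented_graphs n (blow_up T3 t).
                  \<not> bipartite_after_changes (\<alpha> * (real n)\<^sup>2) G})
      \<le> real (f_oriented n (blow_up T3 t)) * 2 powr (- \<epsilon> * (real n)\<^sup>2)
    \<and> real (card {G \<in> free_digraphs n (blow_up T3 t).
                  \<not> bipartite_after_changes (\<alpha> * (real n)\<^sup>2) G})
      \<le> real (f_digraph n (blow_up T3 t)) * 2 powr (- \<epsilon> * (real n)\<^sup>2)"
proof -
  have t: "0 < t" using assms by simp
  obtain \<epsilon>1 where \<epsilon>1: "0 < \<epsilon>1" and ev1: "\<forall>\<^sub>F n in sequentially.
      real (card {G \<in> free_oriented_graphs n (blow_up T3 t). \<not> bipartite_after_changes (\<alpha> * (real n)\<^sup>2) G})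
      \<le> real (f_oriented n (blow_up T3 t)) * 2 powr (- \<epsilon>1 * (real n)\<^sup>2)"
    using almost_all_free_near_bipartite[OF t assms(3), of True]
    unfolding free_graphs_eq f_oriented_def by blast
  obtain \<epsilon>2 where \<epsilon>2: "0 < \<epsilon>2" and ev2: "\<forall>\<^sub>F n in sequentially.
      real (card {G \<in> free_digraphs n (blow_up T3 t). \<not> bipartite_after_changes (\<alpha> * (real n)\<^sup>2) G})
      \<le> real (f_digraph n (blow_up T3 t)) * 2 powr (- \<epsilon>2 * (real n)\<^sup>2)"
    using almost_all_free_near_bipartite[OF t assms(3), of False]
    unfolding free_graphs_eq f_digraph_def by blast
  \<comment> \<open>One constant must serve both counts, and decreasing it weakens either
    bound.\<close>
  define \<epsilon> where "\<epsilon> = min \<epsilon>1 \<epsilon>2"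
  have weaken: "c \<le> real m * 2 powr (- \<epsilon> * (real n)\<^sup>2)"
    if "c \<le> real m * 2 powr (- e * (real n)\<^sup>2)" "\<epsilon> \<le> e" for c e and m n :: nat
  proof -
    have "\<epsilon> * (real n)\<^sup>2 \<le> e * (real n)\<^sup>2" using that by (intro mult_right_mono) auto
    then have "real m * 2 powr (- e * (real n)\<^sup>2) \<le> real m * 2 powr (- \<epsilon> * (real n)\<^sup>2)"
      by (intro mult_left_mono powr_mono) auto
    with that(1) show ?thesis by (rule order_trans)
  qed
  have le: "\<epsilon> \<le> \<epsilon>1" "\<epsilon> \<le> \<epsilon>2" "0 < \<epsilon>" using \<epsilon>1 \<epsilon>2 by (auto simp: \<epsilon>_def)
  from ev1 ev2 have "\<forall>\<^sub>F n in sequentially.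
    real (card {G \<in> free_oriented_graphs n (blow_up T3 t). \<not> bipartite_after_changes (\<alpha> * (real n)\<^sup>2) G})
      \<le> real (f_oriented n (blow_up T3 t)) * 2 powr (- \<epsilon> * (real n)\<^sup>2)
    \<and> real (card {G \<in> free_digraphs n (blow_up T3 t). \<not> bipartite_after_changes (\<alpha> * (real n)\<^sup>2) G})
      \<le> real (f_digraph n (blow_up T3 t)) * 2 powr (- \<epsilon> * (real n)\<^sup>2)"
  proof eventually_elim
    case (elim n)
    show ?case using weaken[OF elim(1) le(1)] weaken[OF elim(2) le(2)] by blast
  qed
  then show ?thesis using le(3) by blast
qed

end
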